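(* Let $D$ be a domain in $\mathbb{R}^n$, $n\geqslant 2$, let $p>n-1$ and let $x_0\in\partial D$, $x_0\neq\infty$. Assume that for any neighborhood $U$ of $x_0$ there are a compact set $E\subset D$, a neighborhood $V\subset U$ of $x_0$ and a number $\delta>0$ such that $$M_p(\Gamma(E,F,D))\geqslant\delta$$ for any continuum $F$ in $D$ with $F\cap\partial U\neq\varnothing\neq F\cap\partial V$. Then for any neighborhood $U$ of $x_0$ and any nondegenerate continuum $E^{*}\subset D$ there are a neighborhood $V\subset U$ of $x_0$ and a number $\delta^{*}>0$ such that $$M_p(\Gamma(E^{*},F,D))\geqslant\delta^{*}$$ for any continuum $F$ in $D$ with $F\cap\partial U\neq\varnothing\neq F\cap\partial V$.
   Context: A continuum is a compact connected set, and continua are understood to be nondegenerate (containing more than one point). For sets $E_0,E_1\subset\overline{\mathbb{R}^n}=\mathbb{R}^n\cup\{\infty\}$ and a domain $D$, $\Gamma(E_0,E_1,D)$ denotes the family of all paths joining $E_0$ and $E_1$ in $D$, i.e. continuous $\gamma:[a,b]\to\overline{\mathbb{R}^n}$ with $\gamma(a)\in E_0$, $\gamma(b)\in E_1$ and $\gamma(t)\in D$ for $a<t<b$. A Borel function $\rho:\mathbb{R}^n\to[0,\infty]$ is admissible for a family $\Gamma$ of paths, written $\rho\in\mathrm{adm}\,\Gamma$, if $\int_\gamma\rho(x)\,|dx|\geqslant 1$ for every locally rectifiable path $\gamma\in\Gamma$. For $p\geqslant 1$ the $p$-modulus of $\Gamma$ is $M_p(\Gamma)=\inf_{\rho\in\mathrm{adm}\,\Gamma}\int_{\mathbb{R}^n}\rho^p(x)\,dm(x)$,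 where $m$ is Lebesgue measure. A family containing a constant path has infinite $p$-modulus (no admissible functions, $\inf\varnothing=\infty$). *)

theory Defs
  imports "HOL-Analysis.Analysis"
begin

definition nondegenerate_continuum :: "'a::topological_space set \<Rightarrow> bool" where
  "nondegenerate_continuum F \<longleftrightarrow>
     compact F \<and> connected F \<and> (\<exists>x\<in>F. \<exists>y\<in>F. x \<noteq> y)"

(* A path gamma : [a,b] \<rightarrow> R^n is the triple (a, b, gamma); only the values of gamma on
   {a..b} matter. *)
type_synonym 'a param_path = "real \<times> real \<times> (real \<Rightarrow> 'a)"

(* Only subsets of the finite space are considered, so E0, E1 and D cannot contain the point
   at infinity and all paths of the family are finite-valued. *)
definition joining_paths ::
    "'a::topological_space set \<Rightarrow> 'a set \<Rightarrow> 'a set \<Rightarrow> 'a param_path set" where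
  "joining_paths E0 E1 D =
     {(a, b, \<gamma>). a < b \<and> continuous_on {a..b} \<gamma> \<and> \<gamma> a \<in> E0 \<and> \<gamma> b \<in> E1 \<and>
        (\<forall>t. a < t \<and> t < b \<longrightarrow> \<gamma> t \<in> D)}"

definition curve_length :: "(real \<Rightarrow> 'a::metric_space) \<Rightarrow> real \<Rightarrow> real \<Rightarrow> ennreal" where
  "curve_length \<gamma> a b =
     (SUP (n, t) \<in> {(n :: nat, t :: nat \<Rightarrow> real).
                      t 0 = a \<and> t n = b \<and> (\<forall>i<n. t i \<le> t (Suc i))}.
        \<Sum>i<n. ennreal (dist (\<gamma> (t i)) (\<gamma> (t (Suc i)))))"

definition locally_rectifiable :: "'a::metric_space param_path \<Rightarrow> bool" where
  "locally_rectifiable = (\<lambda>(a, b, \<gamma>).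
     \<forall>c d. a \<le> c \<and> c \<le> d \<and> d \<le> b \<longrightarrow> curve_length \<gamma> c d < top)"

(* The value does not depend on the choice of t: if the lengths of gamma on [a,t] and on
   [a,t'] are equal and finite, then gamma is constant between t and t'.  For continuous
   rectifiable gamma a suitable t exists for every s between 0 and the length of gamma. *)
definition arclength_param :: "'a::metric_space param_path \<Rightarrow> real \<Rightarrow> 'a" where
  "arclength_param = (\<lambda>(a, b, \<gamma>) s.
     \<gamma> (SOME t. t \<in> {a..b} \<and> curve_length \<gamma> a t = ennreal s))"

(* Meaningful for rectifiable paths only; a locally rectifiable path on a compact interval is
   rectifiable. *)
definition line_integral :: "('a::metric_space \<Rightarrow> ennreal) \<Rightarrow> 'a param_path \<Rightarrow> ennreal" where
  "line_integral \<rho> = (\<lambda>(a, b, \<gamma>).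
     \<integral>\<^sup>+ s \<in> {0..enn2real (curve_length \<gamma> a b)}.
        \<rho> (arclength_param (a, b, \<gamma>) s) \<partial>lborel)"

definition admissible :: "'a::metric_space param_path set \<Rightarrow> ('a \<Rightarrow> ennreal) set" where
  "admissible \<Gamma> =
     {\<rho>. \<rho> \<in> borel_measurable borel \<and>
         (\<forall>c\<in>\<Gamma>. locally_rectifiable c \<longrightarrow> line_integral \<rho> c \<ge> 1)}"

(* Intended for exponents p > 0. *)
definition ennreal_powr :: "ennreal \<Rightarrow> real \<Rightarrow> ennreal" where
  "ennreal_powr x p = (if x = top then top else ennreal (enn2real x powr p))"

definition p_modulus :: "real \<Rightarrow> 'a::euclidean_space param_path set \<Rightarrow> ennreal" where
  "p_modulus p \<Gamma> = (INF \<rho> \<in> admissible \<Gamma>. \<integral>\<^sup>+ x. ennreal_powr (\<rho> x) p \<partial>lborel)"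

end

theory Submission
  imports Defs
begin

text \<open>
  Let \<open>\<rho>\<close> be admissible for \<open>\<Gamma>(E*,F,D)\<close> with a small integral of \<open>\<rho>\<^sup>p\<close>. If some path
  \<open>\<gamma>\<close> from E to F had \<open>\<rho>\<close>-length below 1/2, then the union of F and \<open>\<gamma>\<close> would be a continuum of
  diameter bounded below that meets E, hence connected to E* by a polygon of \<open>\<rho>\<close>-length at most 1/3;
  following \<open>\<gamma>\<close> from there to F contradicts admissibility. So \<open>2\<rho>\<close> is admissible for
  \<open>\<Gamma>(E,F,D)\<close>, and its p-energy is bounded below by hypothesis.

  The polygons come from Morrey's estimate on hyperplane slices of a cube, which is where p > n - 1
  enters: on a slice with small p-energy two given points are joined through a third one at low
  cost. A continuum that leaves a cube meets all slices of a slab in some coordinate direction i,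
  and so does an axis-parallel cross. Crosses of low cost exist near every point, and since they work
  for all directions i at once they serve as intermediate continua along chains of cubes in D.
\<close>

section \<open>Integrals of functions that need not be measurable\<close>

text \<open>The lower bound has to be uniform in F. Every linking statement therefore fixes its
  energy threshold before \<rho> and the continua are given, and compactness of E reduces the
  possible starting points to finitely many. Curves through a single point have p-modulus zero when
  p is at most n, so prescribed points of space cannot be joined cheaply. This is why continua are
  compared, and why this is done inside slices of dimension n - 1, where p exceeds the dimension and
  points do count. The numbers 1/3 and 1/2 only have to add up to less than 1. The lower bound on
  the diameter comes from the choice of the final neighborhood: it is a small ball well inside the
  neighborhood given by the hypothesis, so that F has to cross the gap between them. Line integrals
  are taken along a parametrization defined by a choice operator. Instead of proving that \<rho> is
  measurable along it, the proof only uses inequalities for the integral, as a supremum over simple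
  functions, that hold for arbitrary integrands.\<close>

lemma nn_integral_union_le:
  fixes f :: "'a \<Rightarrow> ennreal"
  assumes "A \<in> sets M" "B \<in> sets M"
  shows "(\<integral>\<^sup>+ x \<in> A \<union> B. f x \<partial>M) \<le> (\<integral>\<^sup>+ x \<in> A. f x \<partial>M) + (\<integral>\<^sup>+ x \<in> B. f x \<partial>M)"
  \<comment> \<open>Each simple function \<open>g\<close> below the integrand is measurable, so
    additivity is available for \<open>g\<close> although it is not for \<open>f\<close>.\<close>
  unfolding nn_integral_def[of M "\<lambda>x. f x * indicator (A \<union> B) x"]
proof (rule SUP_least)
  fix g assume "g \<in> {g. simple_function M g \<and> g \<le> (\<lambda>x. f x * indicator (A \<union> B) x)}"
  then have g: "simple_function M g" and le: "\<And>x. g x \<le> f x * indicator (A \<union> B) x"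
    by (auto simp: le_fun_def)
  have gm [measurable]: "g \<in> borel_measurable M" using g by (rule borel_measurable_simple_function)
  note [measurable] = assms
  have "integral\<^sup>S M g = (\<integral>\<^sup>+ x. g x \<partial>M)" using g by (simp add: nn_integral_eq_simple_integral)
  also have "\<dots> \<le> (\<integral>\<^sup>+ x. g x * indicator A x + g x * indicator B x \<partial>M)"
  proof (rule nn_integral_mono)
    fix x show "g x \<le> g x * indicator A x + g x * indicator B x"
      using le[of x] by (auto simp: indicator_def split: if_splits)
  qed
  also have "\<dots> = (\<integral>\<^sup>+ x \<in> A. g x \<partial>M) + (\<integral>\<^sup>+ x \<in> B. g x \<partial>M)"
    by (rule nn_integral_add) auto
  also have "\<dots> \<le> (\<integral>\<^sup>+ x \<in> A. f x \<partial>M) + (\<integral>\<^sup>+ x \<in> B. f x \<partial>M)"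
  proof (intro add_mono nn_integral_mono)
    fix x
    show "g x * indicator A x \<le> f x * indicator A x" "g x * indicator B x \<le> f x * indicator B x"
      using le[of x] by (auto simp: indicator_def split: if_splits)
  qed
  finally show "integral\<^sup>S M g \<le> \<dots>" .
qed

text \<open>Translation invariance is applied to each simple function below \<open>f\<close>; its
  translate lies below the translate of \<open>f\<close>.\<close>

lemma nn_integral_shift_le:
  fixes f :: "real \<Rightarrow> ennreal"
  shows "(\<integral>\<^sup>+ x. f x \<partial>lborel) \<le> (\<integral>\<^sup>+ x. f (c + x) \<partial>lborel)"
  unfolding nn_integral_def[of lborel f]
proof (rule SUP_least)
  fix g assume "g \<in> {g. simple_function lborel g \<and> g \<le> f}"
  then have g: "simple_function lborel g" and le: "\<And>x. g x \<le> f x"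
    by (auto simp: le_fun_def)
  have gm [measurable]: "g \<in> borel_measurable borel"
    using borel_measurable_simple_function[OF g] by simp
  have "integral\<^sup>S lborel g = (\<integral>\<^sup>+ x. g x \<partial>lborel)" using g by (simp add: nn_integral_eq_simple_integral)
  also have "\<dots> = (\<integral>\<^sup>+ x. g (c + x) \<partial>lborel)"
    using nn_integral_real_affine[of g 1 c] by simp
  also have "\<dots> \<le> (\<integral>\<^sup>+ x. f (c + x) \<partial>lborel)" by (intro nn_integral_mono le)
  finally show "integral\<^sup>S lborel g \<le> \<dots>" .
qed

text \<open>The factor moves into the supremum, and a multiple of a simple function below
  \<open>f\<close> is a candidate for the right-hand side. This serves to double a density along a
  path.\<close>

lemma nn_integral_cmult_ge:
  fixes f :: "'a \<Rightarrow> ennreal"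
  shows "c * (\<integral>\<^sup>+ x. f x \<partial>M) \<le> (\<integral>\<^sup>+ x. c * f x \<partial>M)"
proof -
  have "c * (\<integral>\<^sup>+ x. f x \<partial>M) = (SUP g \<in> {g. simple_function M g \<and> g \<le> f}. c * integral\<^sup>S M g)"
    unfolding nn_integral_def by (rule SUP_mult_left_ennreal)
  also have "\<dots> \<le> (\<integral>\<^sup>+ x. c * f x \<partial>M)"
  proof (rule SUP_least)
    fix g assume "g \<in> {g. simple_function M g \<and> g \<le> f}"
    then have g: "simple_function M g" and le: "\<And>x. g x \<le> f x"
      by (auto simp: le_fun_def)
    have "c * integral\<^sup>S M g = (\<integral>\<^sup>+ x. c * g x \<partial>M)"
      using g borel_measurable_simple_function[OF g]
      by (simp add: nn_integral_eq_simple_integral[symmetric] nn_integral_cmult)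
    also have "\<dots> \<le> (\<integral>\<^sup>+ x. c * f x \<partial>M)" by (intro nn_integral_mono mult_left_mono le) auto
    finally show "c * integral\<^sup>S M g \<le> \<dots>" .
  qed
  finally show ?thesis .
qed

section \<open>Curve length and line integrals\<close>

lemma partition_bounds:
  fixes t :: "nat \<Rightarrow> real"
  assumes "\<forall>i<n. t i \<le> t (Suc i)" "i \<le> n"
  shows "t 0 \<le> t i" "t i \<le> t n"
proof -
  have *: "t i \<le> t j" if "i \<le> j" "j \<le> n" for i j
    using that
  proof (induction j)
    case (Suc j)
    then show ?case using assms(1)
      by (metis Suc_le_lessD le_SucE less_or_eq_imp_le order_trans order_refl)
  qed auto
  show "t 0 \<le> t i" "t i \<le> t n" using *[of 0 i] *[of i n] assms(2) by auto
qed

lemma curve_length_leI: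
  assumes "\<And>n t. t 0 = a \<Longrightarrow> t n = b \<Longrightarrow> \<forall>i<n. t i \<le> t (Suc i) \<Longrightarrow>
    (\<Sum>i<n. ennreal (dist (\<gamma> (t i)) (\<gamma> (t (Suc i))))) \<le> L"
  shows "curve_length \<gamma> a b \<le> L"
  unfolding curve_length_def by (rule SUP_least) (use assms in auto)

lemma curve_length_geI:
  assumes "t 0 = a" "t n = b" "\<forall>i<n. t i \<le> t (Suc i)"
  shows "(\<Sum>i<n. ennreal (dist (\<gamma> (t i)) (\<gamma> (t (Suc i))))) \<le> curve_length \<gamma> a b"
  unfolding curve_length_def
  by (rule order_trans[OF _ SUP_upper[of "(n, t)"]]) (use assms in auto)

lemma curve_length_cong:
  assumes "\<And>t. t \<in> {a..b} \<Longrightarrow> \<gamma> t = \<gamma>' t"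
  shows "curve_length \<gamma> a b = curve_length \<gamma>' a b"
proof -
  have le: "curve_length g a b \<le> curve_length g' a b"
    if eq: "\<And>t. t \<in> {a..b} \<Longrightarrow> g t = g' t" for g g' :: "real \<Rightarrow> 'a"
  proof (rule curve_length_leI)
    fix n and t :: "nat \<Rightarrow> real"
    assume t: "t 0 = a" "t n = b" "\<forall>i<n. t i \<le> t (Suc i)"
    have "g (t i) = g' (t i)" if "i \<le> n" for i
      using partition_bounds[OF t(3) that] t by (intro eq) auto
    then have "(\<Sum>i<n. ennreal (dist (g (t i)) (g (t (Suc i))))) =
        (\<Sum>i<n. ennreal (dist (g' (t i)) (g' (t (Suc i)))))"
      by (intro sum.cong) auto
    also have "\<dots> \<le> curve_length g' a b" using t by (rule curve_length_geI)
    finally show "(\<Sum>i<n. ennreal (dist (g (t i)) (g (t (Suc i))))) \<le> curve_length g' a b" .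
  qed
  show ?thesis using le[of \<gamma> \<gamma>'] le[of \<gamma>' \<gamma>] assms by (simp add: antisym)
qed

lemma dist_le_curve_length:
  assumes "a \<le> b"
  shows "ennreal (dist (\<gamma> a) (\<gamma> b)) \<le> curve_length \<gamma> a b"
  using curve_length_geI[of "\<lambda>i. if i = 0 then a else b" a 1 b \<gamma>] assms by simp

text \<open>In \<open>ennreal\<close> a summand can be moved into a supremum only over a nonempty
  index set; \<open>curve_length_add\<close> needs this twice.\<close>

lemma curve_length_nonempty:
  assumes "a \<le> b"
  shows "{(n :: nat, t :: nat \<Rightarrow> real). t 0 = a \<and> t n = b \<and> (\<forall>i<n. t i \<le> t (Suc i))} \<noteq> {}"
proof -
  have "(1, \<lambda>i. if i = 0 then a else b) \<in>
    {(n :: nat, t :: nat \<Rightarrow> real). t 0 = a \<and> t n = b \<and> (\<forall>i<n. t i \<le> t (Suc i))}"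
    using assms by simp
  then show ?thesis by blast
qed

text \<open>One inequality concatenates partitions. For the other, a partition of the long interval
  is clipped at \<open>b\<close> from above and from below, so that \<open>b\<close> never has to be
  inserted as a new node.\<close>

lemma curve_length_add:
  assumes "a \<le> b" "b \<le> c"
  shows "curve_length \<gamma> a c = curve_length \<gamma> a b + curve_length \<gamma> b c"
proof (rule antisym)
  show "curve_length \<gamma> a c \<le> curve_length \<gamma> a b + curve_length \<gamma> b c"
  proof (rule curve_length_leI)
    fix n and t :: "nat \<Rightarrow> real"
    assume t: "t 0 = a" "t n = c" "\<forall>i<n. t i \<le> t (Suc i)"
    let ?d = "\<lambda>s t. ennreal (dist (\<gamma> s) (\<gamma> t))"
    \<comment> \<open>A step on one side of \<open>b\<close> survives in one of the two clipped
      terms while the other vanishes; a step across \<open>b\<close> is the triangle inequality at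
      \<open>\<gamma> b\<close>.\<close>
    have "(\<Sum>i<n. ?d (t i) (t (Suc i))) \<le>
      (\<Sum>i<n. ?d (min (t i) b) (min (t (Suc i)) b) + ?d (max (t i) b) (max (t (Suc i)) b))"
    proof (rule sum_mono)
      fix i assume "i \<in> {..<n}"
      then have "t i \<le> t (Suc i)" using t by auto
      then show "?d (t i) (t (Suc i)) \<le>
        ?d (min (t i) b) (min (t (Suc i)) b) + ?d (max (t i) b) (max (t (Suc i)) b)"
        using dist_triangle[of "\<gamma> (t i)" "\<gamma> (t (Suc i))" "\<gamma> b"]
        by (auto simp: min_def max_def simp flip: ennreal_plus intro!: ennreal_leI)
    qed
    also have "\<dots> = (\<Sum>i<n. ?d (min (t i) b) (min (t (Suc i)) b)) +
        (\<Sum>i<n. ?d (max (t i) b) (max (t (Suc i)) b))"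
      by (rule sum.distrib)
    also have "\<dots> \<le> curve_length \<gamma> a b + curve_length \<gamma> b c"
      using t assms
      by (intro add_mono curve_length_geI[of "\<lambda>i. min (t i) b"] curve_length_geI[of "\<lambda>i. max (t i) b"])
        (auto simp: min_def max_def intro: order_trans)
    finally show "(\<Sum>i<n. ?d (t i) (t (Suc i))) \<le> curve_length \<gamma> a b + curve_length \<gamma> b c" .
  qed
  have "(case p of (n, t) \<Rightarrow> \<Sum>i<n. ennreal (dist (\<gamma> (t i)) (\<gamma> (t (Suc i))))) +
     (case q of (n, t) \<Rightarrow> \<Sum>i<n. ennreal (dist (\<gamma> (t i)) (\<gamma> (t (Suc i))))) \<le> curve_length \<gamma> a c"
    if p: "p \<in> {(n, t). t 0 = a \<and> t n = b \<and> (\<forall>i<n. t i \<le> t (Suc i))}"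
      and q: "q \<in> {(n, t). t 0 = b \<and> t n = c \<and> (\<forall>i<n. t i \<le> t (Suc i))}" for p q
  proof -
    obtain n t m u where pq: "p = (n, t)" "q = (m, u)" by (cases p, cases q) auto
    \<comment> \<open>At index \<open>n\<close> both branches have the value \<open>b\<close>, so
      \<open>w2\<close> holds for \<open>i = 0\<close> as well.\<close>
    define w where "w = (\<lambda>i. if i \<le> n then t i else u (i - n))"
    have w1: "w i = t i" if "i \<le> n" for i using that by (simp add: w_def)
    have w2: "w (n + i) = u i" for i using p q pq by (auto simp: w_def)
    have "(\<Sum>i<n + m. ennreal (dist (\<gamma> (w i)) (\<gamma> (w (Suc i))))) =
      (\<Sum>i<n. ennreal (dist (\<gamma> (w i)) (\<gamma> (w (Suc i))))) +
      (\<Sum>i<m. ennreal (dist (\<gamma> (w (n + i))) (\<gamma> (w (n + Suc i)))))"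
      by (induction m) (auto simp: add.assoc)
    also have "\<dots> = (\<Sum>i<n. ennreal (dist (\<gamma> (t i)) (\<gamma> (t (Suc i))))) +
      (\<Sum>i<m. ennreal (dist (\<gamma> (u i)) (\<gamma> (u (Suc i)))))"
      unfolding w2 by (intro arg_cong2[of _ _ _ _ "(+)"] sum.cong) (auto simp: w1)
    finally have eq: "(\<Sum>i<n + m. ennreal (dist (\<gamma> (w i)) (\<gamma> (w (Suc i))))) = \<dots>" .
    have "\<forall>i<n + m. w i \<le> w (Suc i)"
    proof (intro allI impI)
      fix i assume "i < n + m"
      show "w i \<le> w (Suc i)"
      proof (cases "i < n")
        case True then show ?thesis using p pq by (auto simp: w1)
      next
        case False
        then obtain j where "i = n + j" using le_Suc_ex not_less by blast
        then show ?thesis using q pq \<open>i < n + m\<close> w2[of j] w2[of "Suc j"] by auto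
      qed
    qed
    then have "(\<Sum>i<n + m. ennreal (dist (\<gamma> (w i)) (\<gamma> (w (Suc i))))) \<le> curve_length \<gamma> a c"
      using p q pq w1[of 0] w2[of m] by (intro curve_length_geI) auto
    then show ?thesis unfolding eq pq by simp
  qed
  note * = this
  show "curve_length \<gamma> a b + curve_length \<gamma> b c \<le> curve_length \<gamma> a c"
    unfolding curve_length_def[of _ a b] curve_length_def[of _ b c]
    apply (subst ennreal_SUP_add_left[OF curve_length_nonempty[OF assms(1)], symmetric])
    apply (rule SUP_least)
    apply (subst ennreal_SUP_add_right[OF curve_length_nonempty[OF assms(2)]])
    apply (rule SUP_least)
    apply (rule *; assumption)
    done
qed

lemma curve_length_affine:
  assumes "a \<le> b" and eq: "\<And>s t. s \<in> {a..b} \<Longrightarrow> t \<in> {a..b} \<Longrightarrow> dist (\<gamma> s) (\<gamma> t) = k * \<bar>s - t\<bar>"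
  shows "curve_length \<gamma> a b = ennreal (k * (b - a))"
proof (rule antisym)
  show "curve_length \<gamma> a b \<le> ennreal (k * (b - a))"
  proof (rule curve_length_leI)
    fix n and t :: "nat \<Rightarrow> real"
    assume t: "t 0 = a" "t n = b" "\<forall>i<n. t i \<le> t (Suc i)"
    have "t i \<in> {a..b}" if "i \<le> n" for i
      using partition_bounds[OF t(3) that] t by auto
    then have d: "dist (\<gamma> (t i)) (\<gamma> (t (Suc i))) = k * t (Suc i) - k * t i" if "i < n" for i
      using that t eq[of "t i" "t (Suc i)"] by (simp add: algebra_simps)
    have "(\<Sum>i<n. ennreal (dist (\<gamma> (t i)) (\<gamma> (t (Suc i))))) =
      ennreal (\<Sum>i<n. dist (\<gamma> (t i)) (\<gamma> (t (Suc i))))"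
      by (rule sum_ennreal) auto
    also have "(\<Sum>i<n. dist (\<gamma> (t i)) (\<gamma> (t (Suc i)))) = (\<Sum>i<n. k * t (Suc i) - k * t i)"
      by (intro sum.cong) (auto simp: d)
    also have "\<dots> = k * (b - a)"
      using t by (subst sum_lessThan_telescope) (simp add: algebra_simps)
    finally show "(\<Sum>i<n. ennreal (dist (\<gamma> (t i)) (\<gamma> (t (Suc i))))) \<le> ennreal (k * (b - a))" by simp
  qed
  show "ennreal (k * (b - a)) \<le> curve_length \<gamma> a b"
    using dist_le_curve_length[OF assms(1), of \<gamma>] eq[of a b] assms(1) by simp
qed

lemma locally_rectifiable_finite:
  "locally_rectifiable (a, b, \<gamma>) \<Longrightarrow> a \<le> c \<Longrightarrow> c \<le> d \<Longrightarrow> d \<le> b \<Longrightarrow> curve_length \<gamma> c d < top"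
  by (simp add: locally_rectifiable_def)

lemma locally_rectifiableI:
  assumes "a \<le> b" "curve_length \<gamma> a b < top"
  shows "locally_rectifiable (a, b, \<gamma>)"
  unfolding locally_rectifiable_def
proof (clarsimp)
  fix c d assume cd: "a \<le> c" "c \<le> d" "d \<le> b"
  have "curve_length \<gamma> a b = curve_length \<gamma> a c + (curve_length \<gamma> c d + curve_length \<gamma> d b)"
    using cd by (simp add: curve_length_add[of a c b] curve_length_add[of c d b])
  then have "curve_length \<gamma> c d \<le> curve_length \<gamma> a b"
    by (simp add: add_increasing add_increasing2)
  then show "curve_length \<gamma> c d < top" using assms(2) by (rule le_less_trans)
qed

lemma add_eq_ennreal_iff:
  assumes "0 \<le> k" "k \<le> s"
  shows "ennreal k + e = ennreal s \<longleftrightarrow> e = ennreal (s - k)"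
  using assms by (cases e) (auto simp flip: ennreal_plus simp: ennreal_minus)

text \<open>Both curves are evaluated at the same choice of parameter, because the predicates under
  the choice operator coincide. Only the upper bound for the shifted integral is available, since
  the integrands are not known to be measurable.\<close>

lemma line_integral_subpath_le:
  assumes "locally_rectifiable (a, b, \<gamma>)" "a \<le> c" "c \<le> b"
  shows "line_integral \<rho> (c, b, \<gamma>) \<le> line_integral \<rho> (a, b, \<gamma>)"
proof -
  have fin: "curve_length \<gamma> a c < top" "curve_length \<gamma> c b < top"
    using assms by (auto intro: locally_rectifiable_finite)
  define k where "k = enn2real (curve_length \<gamma> a c)"
  define L where "L = enn2real (curve_length \<gamma> c b)"
  have k: "curve_length \<gamma> a c = ennreal k" "k \<ge> 0" and L: "curve_length \<gamma> c b = ennreal L" "L \<ge> 0"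
    using fin by (auto simp: k_def L_def)
  have tot: "enn2real (curve_length \<gamma> a b) = k + L"
    using assms k L by (simp add: curve_length_add[of a c b] flip: ennreal_plus)
  have eq: "arclength_param (c, b, \<gamma>) (s - k) = arclength_param (a, b, \<gamma>) s" if "s > k" for s
  proof -
    have "(t \<in> {c..b} \<and> curve_length \<gamma> c t = ennreal (s - k)) \<longleftrightarrow>
      (t \<in> {a..b} \<and> curve_length \<gamma> a t = ennreal s)" for t
    proof (cases "t \<ge> c")
      case True
      then show ?thesis using k that assms
        by (auto simp: curve_length_add[of a c t] add_eq_ennreal_iff)
    next
      case False
      have "curve_length \<gamma> a t \<noteq> ennreal s" if "a \<le> t"
      proof -
        have "curve_length \<gamma> a t \<le> ennreal k"
          using False that k(1)[symmetric] by (simp add: curve_length_add[of a t c])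
        moreover have "ennreal k < ennreal s" using \<open>s > k\<close> k by (simp add: ennreal_less_iff)
        ultimately show ?thesis by auto
      qed
      then show ?thesis using False assms by auto
    qed
    then show ?thesis by (simp add: arclength_param_def)
  qed
  have "line_integral \<rho> (c, b, \<gamma>) =
    (\<integral>\<^sup>+ s \<in> {0..L}. \<rho> (arclength_param (c, b, \<gamma>) s) \<partial>lborel)"
    by (simp add: line_integral_def L_def)
  \<comment> \<open>The parameter 0 is split off: at arc length exactly \<open>k\<close> the choice
    for the long path may fall before \<open>c\<close> if the path rests there. A single point
    contributes nothing.\<close>
  also have "\<dots> \<le> (\<integral>\<^sup>+ s \<in> {0<..L} \<union> {0}. \<rho> (arclength_param (c, b, \<gamma>) s) \<partial>lborel)"
    by (intro nn_integral_mono) (auto simp: indicator_def)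
  also have "\<dots> \<le> (\<integral>\<^sup>+ s \<in> {0<..L}. \<rho> (arclength_param (c, b, \<gamma>) s) \<partial>lborel) +
      (\<integral>\<^sup>+ s \<in> {0}. \<rho> (arclength_param (c, b, \<gamma>) s) \<partial>lborel)"
    by (rule nn_integral_union_le) auto
  also have "(\<integral>\<^sup>+ s \<in> {0}. \<rho> (arclength_param (c, b, \<gamma>) s) \<partial>lborel) = 0"
    by (simp add: nn_integral_indicator_singleton)
  also have "(\<integral>\<^sup>+ s \<in> {0<..L}. \<rho> (arclength_param (c, b, \<gamma>) s) \<partial>lborel) \<le>
      (\<integral>\<^sup>+ s. \<rho> (arclength_param (c, b, \<gamma>) (- k + s)) * indicator {0<..L} (- k + s) \<partial>lborel)"
    by (rule nn_integral_shift_le)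
  also have "\<dots> \<le> (\<integral>\<^sup>+ s \<in> {0..k + L}. \<rho> (arclength_param (a, b, \<gamma>) s) \<partial>lborel)"
    using eq k by (intro nn_integral_mono) (auto simp: indicator_def)
  also have "\<dots> = line_integral \<rho> (a, b, \<gamma>)" by (simp add: line_integral_def tot)
  finally show ?thesis by simp
qed

text \<open>The integral of \<rho> along the segment with respect to arc length. With the unit
  interval as parameter domain the formula is measurable in the end points, and a degenerate segment
  costs 0 even where \<rho> is infinite.\<close>

definition segment_cost :: "('a::real_normed_vector \<Rightarrow> ennreal) \<Rightarrow> 'a \<Rightarrow> 'a \<Rightarrow> ennreal" where
  "segment_cost \<rho> x y = ennreal (dist x y) * (\<integral>\<^sup>+ s \<in> {0..1}. \<rho> (x + s *\<^sub>R (y - x)) \<partial>lborel)"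

lemma segment_cost_commute:
  fixes \<rho> :: "'a::euclidean_space \<Rightarrow> ennreal"
  assumes [measurable]: "\<rho> \<in> borel_measurable borel"
  shows "segment_cost \<rho> x y = segment_cost \<rho> y x"
proof -
  have "(\<integral>\<^sup>+ s \<in> {0..1}. \<rho> (x + s *\<^sub>R (y - x)) \<partial>lborel) =
    (\<integral>\<^sup>+ s. \<rho> (x + (1 + (-1) * s) *\<^sub>R (y - x)) * indicator {0..1} (1 + (-1) * s) \<partial>lborel)"
    by (subst nn_integral_real_affine[where c = "-1" and t = 1]) auto
  also have "\<dots> = (\<integral>\<^sup>+ s \<in> {0..1}. \<rho> (y + s *\<^sub>R (x - y)) \<partial>lborel)"
    by (intro nn_integral_cong) (auto simp: indicator_def algebra_simps)
  finally show ?thesis by (simp add: segment_cost_def dist_commute)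
qed

lemma segment_cost_refl [simp]: "segment_cost \<rho> x x = 0"
  by (simp add: segment_cost_def)

text \<open>In arc length the new path runs through the segment on \<open>[0, k)\<close> and through
  the old path, shifted by \<open>k\<close>, beyond \<open>k\<close>. This replaces additivity of
  the line integral under concatenation; a bound from above suffices.\<close>

lemma prepend_segment:
  fixes \<gamma> :: "real \<Rightarrow> 'a::euclidean_space"
  assumes "a < b" "continuous_on {a..b} \<gamma>" "\<gamma> ` {a..b} \<subseteq> D" "locally_rectifiable (a, b, \<gamma>)"
    and seg: "closed_segment x (\<gamma> a) \<subseteq> D" and [measurable]: "\<rho> \<in> borel_measurable borel"
  obtains a' \<gamma>' where "a' < b" "continuous_on {a'..b} \<gamma>'" "\<gamma>' ` {a'..b} \<subseteq> D"
    "locally_rectifiable (a', b, \<gamma>')" "\<gamma>' a' = x" "\<gamma>' b = \<gamma> b"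
    "line_integral \<rho> (a', b, \<gamma>') \<le> segment_cost \<rho> x (\<gamma> a) + line_integral \<rho> (a, b, \<gamma>)"
proof (cases "x = \<gamma> a")
  case True
  then show ?thesis using that[of a \<gamma>] assms by simp
next
  case False
  define y where "y = \<gamma> a"
  define k where "k = dist x y"
  have k: "k > 0" using False by (simp add: k_def y_def)
  \<comment> \<open>On the set where the choice in the arc length parametrization is empty, the old and the
    new path are evaluated at t0, so they have to agree there.\<close>
  define t0 where "t0 = (SOME t :: real. False)"
  define a' where "a' = (if t0 < a then (t0 + a) / 2 else a - 1)"
  have a': "a' < a" "t0 < a' \<or> a \<le> t0" by (auto simp: a'_def)
  \<comment> \<open>Only the values on the half-open interval from \<open>a'\<close> to
    \<open>a\<close> change. Left of \<open>a'\<close>, off the path but possibly at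
    \<open>t0\<close>, the values of \<open>\<gamma>\<close> are kept.\<close>
  define \<gamma>' where "\<gamma>' = (\<lambda>t. if a' \<le> t \<and> t < a then x + ((t - a') / (a - a')) *\<^sub>R (y - x) else \<gamma> t)"
  have g1: "\<gamma>' t = x + ((t - a') / (a - a')) *\<^sub>R (y - x)" if "t \<in> {a'..a}" for t
    using that a' by (cases "t = a") (auto simp: \<gamma>'_def y_def)
  have g2: "\<gamma>' t = \<gamma> t" if "t \<ge> a \<or> t = t0" for t
    using that a' by (auto simp: \<gamma>'_def)
  have cont: "continuous_on {a'..b} \<gamma>'"
  proof -
    have "continuous_on {a'..a} \<gamma>'"
      by (rule continuous_on_eq[where f = "\<lambda>t. x + ((t - a') / (a - a')) *\<^sub>R (y - x)"])
        (use g1 a' in \<open>auto intro!: continuous_intros\<close>)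
    moreover have "continuous_on {a..b} \<gamma>'"
      by (rule continuous_on_eq[OF assms(2)]) (use g2 in auto)
    ultimately have "continuous_on ({a'..a} \<union> {a..b}) \<gamma>'"
      by (intro continuous_on_closed_Un) auto
    moreover have "{a'..a} \<union> {a..b} = {a'..b}" using a' assms(1) by auto
    ultimately show ?thesis by simp
  qed
  have img: "\<gamma>' ` {a'..b} \<subseteq> D"
  proof clarify
    fix t assume t: "t \<in> {a'..b}"
    show "\<gamma>' t \<in> D"
    proof (cases "t < a")
      case True
      define u where "u = (t - a') / (a - a')"
      have u: "0 \<le> u" "u \<le> 1" using t True a' by (auto simp: u_def)
      have "\<gamma>' t = (1 - u) *\<^sub>R x + u *\<^sub>R \<gamma> a" using g1[of t] t True by (simp add: u_def y_def algebra_simps)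
      then show ?thesis using seg u by (auto simp: closed_segment_def)
    next
      case False
      then show ?thesis using g2[of t] t assms(3) by auto
    qed
  qed
  have len1: "curve_length \<gamma>' a' t = ennreal (k * (t - a') / (a - a'))" if t: "t \<in> {a'..a}" for t
  proof -
    have "curve_length \<gamma>' a' t = ennreal (k / (a - a') * (t - a'))"
    proof (rule curve_length_affine)
      fix s u assume "s \<in> {a'..t}" "u \<in> {a'..t}"
      then have "\<gamma>' s - \<gamma>' u = ((s - u) / (a - a')) *\<^sub>R (y - x)"
        using t by (simp add: g1 diff_divide_distrib algebra_simps)
      then show "dist (\<gamma>' s) (\<gamma>' u) = k / (a - a') * \<bar>s - u\<bar>"
        using a' by (simp add: dist_norm k_def norm_minus_commute)
    qed (use t in auto)
    then show ?thesis by simp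
  qed
  have len2: "curve_length \<gamma>' a' t = ennreal k + curve_length \<gamma> a t" if t: "a \<le> t" "t \<le> b" for t
  proof -
    have "curve_length \<gamma>' a t = curve_length \<gamma> a t"
      by (rule curve_length_cong) (use g2 in auto)
    then show ?thesis using t a' len1[of a] by (simp add: curve_length_add[of a' a t])
  qed
  define L where "L = enn2real (curve_length \<gamma> a b)"
  have L: "curve_length \<gamma> a b = ennreal L" "L \<ge> 0"
    using locally_rectifiable_finite[OF assms(4), of a b] assms(1) by (auto simp: L_def)
  have tot: "curve_length \<gamma>' a' b = ennreal (k + L)"
    using len2[of b] assms(1) L k by simp
  have rect: "locally_rectifiable (a', b, \<gamma>')"
    by (rule locally_rectifiableI) (use tot a' assms(1) in auto)
  let ?P = "\<lambda>s t. t \<in> {a'..b} \<and> curve_length \<gamma>' a' t = ennreal s"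
  \<comment> \<open>Below length \<open>k\<close> exactly one parameter has the required length, so
    the choice is determined. At \<open>k\<close> it need not be, since the old path may start by
    resting.\<close>
  have A: "arclength_param (a', b, \<gamma>') s = x + (s / k) *\<^sub>R (y - x)" if s: "s \<in> {0..<k}" for s
  proof -
    have iff: "?P s t \<longleftrightarrow> t = a' + (a - a') * s / k" for t
    proof (cases "t \<in> {a'..a}")
      case True
      then have "?P s t \<longleftrightarrow> k * (t - a') / (a - a') = s"
        using len1[of t] s a' assms(1) k by auto
      also have "\<dots> \<longleftrightarrow> t = a' + (a - a') * s / k"
        using k a' by (auto simp: field_simps)
      finally show ?thesis .
    next
      case False
      have *: "a' + (a - a') * s / k \<in> {a'..a}"
      proof -
        have "(a - a') * s \<le> (a - a') * k" using s a' by (intro mult_left_mono) auto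
        moreover have "0 \<le> (a - a') * s" using s a' by simp
        ultimately show ?thesis using k by (auto simp: field_simps)
      qed
      have "\<not> ?P s t"
      proof
        assume P: "?P s t"
        then have "ennreal k \<le> ennreal s" using False len2[of t]
          by (metis atLeastAtMost_iff le_cases le_iff_add)
        then show False using s by (simp add: ennreal_le_iff)
      qed
      then show ?thesis using False * by auto
    qed
    define t where "t = a' + (a - a') * s / k"
    have "arclength_param (a', b, \<gamma>') s = \<gamma>' t"
      unfolding arclength_param_def using iff by (simp add: t_def)
    also have "t \<in> {a'..a}"
    proof -
      have "(a - a') * s \<le> (a - a') * k" using s a' by (intro mult_left_mono) auto
      moreover have "0 \<le> (a - a') * s" using s a' by simp
      ultimately show ?thesis using k by (auto simp: t_def field_simps)
    qed
    then have "\<gamma>' t = x + (s / k) *\<^sub>R (y - x)" using g1[of t] a' k by (simp add: t_def)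
    finally show ?thesis .
  qed
  \<comment> \<open>Beyond length \<open>k\<close> both choice predicates are the same, so both
    choices return the same parameter, whether or not the predicate is satisfiable.\<close>
  have B: "arclength_param (a', b, \<gamma>') s = arclength_param (a, b, \<gamma>) (s - k)" if s: "s > k" for s
  proof -
    have iff: "?P s t \<longleftrightarrow> t \<in> {a..b} \<and> curve_length \<gamma> a t = ennreal (s - k)" for t
    proof (cases "a \<le> t")
      case True
      then show ?thesis
        using len2[of t] a' add_eq_ennreal_iff[of k s "curve_length \<gamma> a t"] k s by auto
    next
      case False
      have "\<not> ?P s t"
      proof
        assume P: "?P s t"
        then have "k * (t - a') / (a - a') = s" using False len1[of t] a' k s by auto
        moreover have "k * (t - a') / (a - a') \<le> k" using P False a' k by (auto simp: field_simps)
        ultimately show False using s by simp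
      qed
      then show ?thesis using False by auto
    qed
    define T where "T = (SOME t. ?P s t)"
    have T: "T = (SOME t. t \<in> {a..b} \<and> curve_length \<gamma> a t = ennreal (s - k))"
      using iff by (simp add: T_def)
    have "T \<ge> a \<or> T = t0"
    proof (cases "\<exists>t. t \<in> {a..b} \<and> curve_length \<gamma> a t = ennreal (s - k)")
      case True
      then have "T \<in> {a..b} \<and> curve_length \<gamma> a T = ennreal (s - k)" unfolding T by (rule someI_ex)
      then show ?thesis by simp
    next
      case False
      then have "(\<lambda>t. t \<in> {a..b} \<and> curve_length \<gamma> a t = ennreal (s - k)) = (\<lambda>t. False)" by auto
      then show ?thesis unfolding T t0_def by (simp only: simp_thms)
    qed
    then have "\<gamma>' T = \<gamma> T" by (rule g2)
    then show ?thesis using T by (simp add: arclength_param_def T_def)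
  qed
  have "line_integral \<rho> (a', b, \<gamma>') =
      (\<integral>\<^sup>+ s \<in> {0..k + L}. \<rho> (arclength_param (a', b, \<gamma>') s) \<partial>lborel)"
    using tot k L by (simp add: line_integral_def del: ennreal_plus)
  \<comment> \<open>The arc length \<open>k\<close>, covered neither by \<open>A\<close> nor by
    \<open>B\<close>, is isolated as a null set.\<close>
  also have "{0..k + L} = {0..<k} \<union> ({k} \<union> {k<..k + L})" using k L by auto
  also have "(\<integral>\<^sup>+ s \<in> {0..<k} \<union> ({k} \<union> {k<..k + L}). \<rho> (arclength_param (a', b, \<gamma>') s) \<partial>lborel) \<le>
      (\<integral>\<^sup>+ s \<in> {0..<k}. \<rho> (arclength_param (a', b, \<gamma>') s) \<partial>lborel) +
      (\<integral>\<^sup>+ s \<in> {k} \<union> {k<..k + L}. \<rho> (arclength_param (a', b, \<gamma>') s) \<partial>lborel)"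
    by (rule nn_integral_union_le) auto
  also have "\<dots> \<le> (\<integral>\<^sup>+ s \<in> {0..<k}. \<rho> (arclength_param (a', b, \<gamma>') s) \<partial>lborel) +
      ((\<integral>\<^sup>+ s \<in> {k}. \<rho> (arclength_param (a', b, \<gamma>') s) \<partial>lborel) +
       (\<integral>\<^sup>+ s \<in> {k<..k + L}. \<rho> (arclength_param (a', b, \<gamma>') s) \<partial>lborel))"
    by (intro add_left_mono nn_integral_union_le) auto
  also have "(\<integral>\<^sup>+ s \<in> {k}. \<rho> (arclength_param (a', b, \<gamma>') s) \<partial>lborel) = 0"
    by (simp add: nn_integral_indicator_singleton)
  also have "(\<integral>\<^sup>+ s \<in> {0..<k}. \<rho> (arclength_param (a', b, \<gamma>') s) \<partial>lborel) \<le> segment_cost \<rho> x y"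
  proof -
    have "(\<integral>\<^sup>+ s \<in> {0..<k}. \<rho> (arclength_param (a', b, \<gamma>') s) \<partial>lborel) \<le>
      (\<integral>\<^sup>+ s \<in> {0..k}. \<rho> (x + (s / k) *\<^sub>R (y - x)) \<partial>lborel)"
      using A by (intro nn_integral_mono) (auto simp: indicator_def)
    also have "\<dots> = ennreal \<bar>k\<bar> * (\<integral>\<^sup>+ s. \<rho> (x + ((0 + k * s) / k) *\<^sub>R (y - x)) * indicator {0..k} (0 + k * s) \<partial>lborel)"
      using k by (intro nn_integral_real_affine) auto
    also have "(\<integral>\<^sup>+ s. \<rho> (x + ((0 + k * s) / k) *\<^sub>R (y - x)) * indicator {0..k} (0 + k * s) \<partial>lborel) =
      (\<integral>\<^sup>+ s \<in> {0..1}. \<rho> (x + s *\<^sub>R (y - x)) \<partial>lborel)"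
      using k by (intro nn_integral_cong) (auto simp: indicator_def zero_le_mult_iff)
    finally show ?thesis using k by (simp add: segment_cost_def k_def)
  qed
  also have "(\<integral>\<^sup>+ s \<in> {k<..k + L}. \<rho> (arclength_param (a', b, \<gamma>') s) \<partial>lborel) \<le> line_integral \<rho> (a, b, \<gamma>)"
  proof -
    have "(\<integral>\<^sup>+ s \<in> {k<..k + L}. \<rho> (arclength_param (a', b, \<gamma>') s) \<partial>lborel) \<le>
      (\<integral>\<^sup>+ s. \<rho> (arclength_param (a', b, \<gamma>') (k + s)) * indicator {k<..k + L} (k + s) \<partial>lborel)"
      by (rule nn_integral_shift_le)
    also have "\<dots> \<le> (\<integral>\<^sup>+ s \<in> {0..L}. \<rho> (arclength_param (a, b, \<gamma>) s) \<partial>lborel)"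
      using B by (intro nn_integral_mono) (auto simp: indicator_def)
    finally show ?thesis by (simp add: line_integral_def L_def)
  qed
  finally have "line_integral \<rho> (a', b, \<gamma>') \<le> segment_cost \<rho> x (\<gamma> a) + line_integral \<rho> (a, b, \<gamma>)"
    by (simp add: y_def add_mono)
  then show ?thesis
    using that[of a' \<gamma>'] a' assms(1) cont img rect g1[of a'] g2[of b] by auto
qed

section \<open>Polygons and their cost\<close>

inductive polygon_cost :: "('a::euclidean_space \<Rightarrow> ennreal) \<Rightarrow> 'a set \<Rightarrow> 'a \<Rightarrow> 'a \<Rightarrow> ennreal \<Rightarrow> bool"
  for \<rho> D where
  refl: "a \<in> D \<Longrightarrow> polygon_cost \<rho> D a a 0"
| step: "polygon_cost \<rho> D a b u \<Longrightarrow> closed_segment b c \<subseteq> D \<Longrightarrow>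
    polygon_cost \<rho> D a c (u + segment_cost \<rho> b c)"

lemma polygon_cost_trans:
  assumes "polygon_cost \<rho> D b c v" "polygon_cost \<rho> D a b u"
  shows "polygon_cost \<rho> D a c (u + v)"
  using assms
proof (induction rule: polygon_cost.induct)
  case (step b c v d)
  then show ?case using polygon_cost.step[of \<rho> D a c "u + v" d] by (simp add: add.assoc)
qed auto

lemma polygon_cost_segment:
  assumes "closed_segment a b \<subseteq> D"
  shows "polygon_cost \<rho> D a b (segment_cost \<rho> a b)"
  using polygon_cost.step[OF polygon_cost.refl assms] assms by force

lemma polygon_cost_sym:
  assumes "polygon_cost \<rho> D a b u" "\<rho> \<in> borel_measurable borel"
  shows "polygon_cost \<rho> D b a u"
  using assms
proof (induction rule: polygon_cost.induct)
  case (step a b u c)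
  have "polygon_cost \<rho> D c b (segment_cost \<rho> c b)"
    using step by (intro polygon_cost_segment) (simp add: closed_segment_commute)
  from polygon_cost_trans[OF step.IH[OF step.prems] this] show ?case
    by (simp add: add.commute segment_cost_commute[OF step.prems, of b c])
qed (auto intro: polygon_cost.refl)

text \<open>Polygons grow at their far end, so rule induction removes the segment next to the path.
  That segment is prepended before the induction hypothesis is applied, which is why
  \<open>a\<close> and \<open>\<gamma>\<close> are generalized.\<close>

lemma prepend_polygon:
  assumes "polygon_cost \<rho> D x y u" "\<rho> \<in> borel_measurable borel"
    and "a < b" "continuous_on {a..b} \<gamma>" "\<gamma> ` {a..b} \<subseteq> D" "locally_rectifiable (a, b, \<gamma>)" "\<gamma> a = y"
  shows "\<exists>a' \<gamma>'. a' < b \<and> continuous_on {a'..b} \<gamma>' \<and> \<gamma>' ` {a'..b} \<subseteq> D \<and>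
    locally_rectifiable (a', b, \<gamma>') \<and> \<gamma>' a' = x \<and> \<gamma>' b = \<gamma> b \<and>
    line_integral \<rho> (a', b, \<gamma>') \<le> u + line_integral \<rho> (a, b, \<gamma>)"
  using assms
proof (induction arbitrary: a \<gamma> rule: polygon_cost.induct)
  case (refl x)
  then show ?case by (intro exI[of _ a] exI[of _ \<gamma>]) auto
next
  case (step x y u z)
  obtain a1 g where g: "a1 < b" "continuous_on {a1..b} g" "g ` {a1..b} \<subseteq> D"
    "locally_rectifiable (a1, b, g)" "g a1 = y" "g b = \<gamma> b"
    "line_integral \<rho> (a1, b, g) \<le> segment_cost \<rho> y (\<gamma> a) + line_integral \<rho> (a, b, \<gamma>)"
    using prepend_segment[of a b \<gamma> D y \<rho>] step.prems step.hyps by metis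
  obtain a' h where h: "a' < b" "continuous_on {a'..b} h" "h ` {a'..b} \<subseteq> D"
    "locally_rectifiable (a', b, h)" "h a' = x" "h b = g b"
    "line_integral \<rho> (a', b, h) \<le> u + line_integral \<rho> (a1, b, g)"
    using step.IH[of a1 g] g step.prems by metis
  have "line_integral \<rho> (a', b, h) \<le> u + (segment_cost \<rho> y z + line_integral \<rho> (a, b, \<gamma>))"
    using h(7) g(7) step.prems by (meson add_left_mono order_trans)
  then show ?case using h g by (intro exI[of _ a'] exI[of _ h]) (auto simp: add.assoc)
qed

section \<open>Slices of cubes\<close>

lemma measurable_ennreal_powr [measurable]:
  "(\<lambda>x. ennreal_powr x p) \<in> borel_measurable borel"
  unfolding ennreal_powr_def by measurable

text \<open>Either \<open>x\<close> is at most \<open>l\<close>, or the power of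
  \<open>x / l\<close> with exponent \<open>p - 1\<close> is at least 1. This form of Young's
  inequality replaces Hoelder's; the free level \<open>l\<close> may later depend on the position
  along a segment.\<close>

lemma ennreal_le_add_powr:
  assumes "l > 0" "p \<ge> 1"
  shows "x \<le> ennreal l + ennreal (l powr (1 - p)) * ennreal_powr x p"
proof (cases x)
  case (real r)
  have "r \<le> l + l powr (1 - p) * r powr p"
  proof (cases "r \<le> l")
    case True
    then show ?thesis using assms by (simp add: add_increasing2)
  next
    case False
    then have "l powr (p - 1) \<le> r powr (p - 1)" using assms by (intro powr_mono2) auto
    then have "l powr (1 - p) * l powr (p - 1) * r \<le> l powr (1 - p) * (r powr (p - 1) * r)"
      using False assms by (simp add: mult_left_mono mult_right_mono mult.assoc)
    also have "r powr (p - 1) * r = r powr p" using False assms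
      by (simp add: powr_diff)
    also have "l powr (1 - p) * l powr (p - 1) = 1" using assms by (simp flip: powr_add)
    finally show ?thesis using assms by simp
  qed
  then show ?thesis using real assms
    by (simp add: ennreal_powr_def flip: ennreal_plus ennreal_mult)
next
  case top
  then show ?thesis using assms by (simp add: ennreal_powr_def ennreal_mult_top)
qed

text \<open>If \<open>h\<close> exceeded the bound on all of \<open>A\<close>, its integral would be
  at least \<open>2 * K\<close>. The factor 2 makes the contradiction strict.\<close>

lemma exists_le_average:
  assumes "A \<in> sets M" "emeasure M A = ennreal m" "m > 0" "K > 0"
    and le: "(\<integral>\<^sup>+ x \<in> A. h x \<partial>M) \<le> ennreal K"
  shows "\<exists>x\<in>A. h x \<le> ennreal (2 * K / m)"
proof (rule ccontr)
  assume "\<not> ?thesis"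
  then have *: "ennreal (2 * K / m) \<le> h x" if "x \<in> A" for x using that by force
  have "ennreal (2 * K) = ennreal (2 * K / m) * emeasure M A"
    using assms by (simp flip: ennreal_mult)
  also have "\<dots> = (\<integral>\<^sup>+ x \<in> A. ennreal (2 * K / m) \<partial>M)"
    using assms by (simp add: nn_integral_cmult_indicator)
  also have "\<dots> \<le> (\<integral>\<^sup>+ x \<in> A. h x \<partial>M)"
    using * by (intro nn_integral_mono) (auto simp: indicator_def)
  also have "\<dots> \<le> ennreal K" by (rule le)
  finally show False using assms by (simp add: ennreal_le_iff)
qed

lemma nn_integral_lborel_translate:
  fixes f :: "'a::euclidean_space \<Rightarrow> ennreal"
  assumes [measurable]: "f \<in> borel_measurable borel"
  shows "(\<integral>\<^sup>+ x. f (c + x) \<partial>lborel) = (\<integral>\<^sup>+ x. f x \<partial>lborel)"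
  by (subst lborel_affine[of 1 c]) (simp_all add: nn_integral_density nn_integral_distr)

section \<open>Cubes, the balls of the maximum norm, and their slices\<close>

definition cube :: "'a::euclidean_space \<Rightarrow> real \<Rightarrow> 'a set" where
  "cube x R = cbox (x - R *\<^sub>R One) (x + R *\<^sub>R One)"

lemma mem_cube: "y \<in> cube x R \<longleftrightarrow> (\<forall>i\<in>Basis. \<bar>y \<bullet> i - x \<bullet> i\<bar> \<le> R)"
  by (auto simp: cube_def mem_box algebra_simps abs_le_iff)

lemma cube_measurable [measurable]: "cube x R \<in> sets borel"
  by (simp add: cube_def)

lemma convex_cube: "convex (cube x R)"
  by (simp add: cube_def convex_box)

lemma emeasure_cube:
  assumes "R \<ge> 0"
  shows "emeasure lborel (cube (x :: 'a::euclidean_space) R) = ennreal ((2 * R) ^ DIM('a))"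
proof -
  have "emeasure lborel (cube x R) = ennreal (\<Prod>b\<in>Basis. ((x + R *\<^sub>R One) - (x - R *\<^sub>R One)) \<bullet> b)"
    unfolding cube_def using assms by (intro emeasure_lborel_cbox) (auto simp: algebra_simps)
  also have "(\<Prod>b\<in>(Basis :: 'a set). ((x + R *\<^sub>R One) - (x - R *\<^sub>R One)) \<bullet> b) = (\<Prod>b\<in>(Basis :: 'a set). 2 * R)"
    by (intro prod.cong) (auto simp: algebra_simps)
  finally show ?thesis by simp
qed

lemma dist_cube_le:
  fixes x :: "'a::euclidean_space"
  assumes "y \<in> cube x R" "z \<in> cube x R"
  shows "dist y z \<le> real DIM('a) * (2 * R)"
proof -
  have "dist y z \<le> (\<Sum>i\<in>Basis. \<bar>(y - z) \<bullet> i\<bar>)" by (simp add: dist_norm norm_le_l1)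
  also have "\<dots> \<le> (\<Sum>i\<in>(Basis :: 'a set). 2 * R)"
    using assms by (intro sum_mono) (force simp: mem_cube inner_diff_left abs_le_iff)
  finally show ?thesis by simp
qed

text \<open>Integrals over the slice of a cube at height t are written as integrals of
  \<open>u \<mapsto> g (slice_proj i t u)\<close> over the whole cube, which multiplies them by the side length of the
  cube and makes (n-1)-dimensional measures unnecessary.\<close>

definition slice_proj :: "'a::euclidean_space \<Rightarrow> real \<Rightarrow> 'a \<Rightarrow> 'a" where
  "slice_proj i t u = u + (t - u \<bullet> i) *\<^sub>R i"

lemma slice_proj_inner:
  assumes "i \<in> Basis" "j \<in> Basis"
  shows "slice_proj i t u \<bullet> j = (if j = i then t else u \<bullet> j)"
  using assms by (auto simp: slice_proj_def inner_add_left inner_Basis)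

lemma slice_proj_in_cube:
  assumes "i \<in> Basis" "\<bar>t - x \<bullet> i\<bar> \<le> R" "u \<in> cube x R"
  shows "slice_proj i t u \<in> cube x R"
  using assms by (auto simp: mem_cube slice_proj_inner)

lemma slice_proj_measurable [measurable]:
  "(\<lambda>(t, u). slice_proj i t u) \<in> borel \<Otimes>\<^sub>M borel \<rightarrow>\<^sub>M borel"
  "slice_proj i t \<in> borel \<rightarrow>\<^sub>M borel"
  unfolding slice_proj_def by measurable

text \<open>Fubini's theorem for slices. The factor \<open>2 * R\<close> appears because each slice
  integral also averages over the coordinate that the projection forgets.\<close>

lemma nn_integral_slices:
  fixes g :: "'a::euclidean_space \<Rightarrow> ennreal"
  assumes i: "i \<in> Basis" and R: "R \<ge> 0" and [measurable]: "g \<in> borel_measurable borel"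
  shows "(\<integral>\<^sup>+ t \<in> {x \<bullet> i - R..x \<bullet> i + R}. (\<integral>\<^sup>+ u \<in> cube x R. g (slice_proj i t u) \<partial>lborel) \<partial>lborel) =
    ennreal (2 * R) * (\<integral>\<^sup>+ u \<in> cube x R. g u \<partial>lborel)"
proof -
  let ?J = "\<lambda>t. indicator {x \<bullet> i - R..x \<bullet> i + R} t :: ennreal"
  let ?Q = "\<lambda>u. indicator (cube x R) u :: ennreal"
  have "(\<integral>\<^sup>+ t. (\<integral>\<^sup>+ u. g (slice_proj i t u) * ?Q u \<partial>lborel) * ?J t \<partial>lborel) =
      (\<integral>\<^sup>+ t. (\<integral>\<^sup>+ u. g (slice_proj i t u) * ?Q u * ?J t \<partial>lborel) \<partial>lborel)"
    by (subst nn_integral_multc[symmetric]) auto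
  also have "\<dots> = (\<integral>\<^sup>+ u. (\<integral>\<^sup>+ t. g (slice_proj i t u) * ?Q u * ?J t \<partial>lborel) \<partial>lborel)"
    by (rule lborel_pair.Fubini') auto
  \<comment> \<open>The substitution of \<open>u \<bullet> i + s\<close> for \<open>t\<close> turns
    the projection into the translation by \<open>s *\<^sub>R i\<close>.\<close>
  also have "\<dots> = (\<integral>\<^sup>+ u. (\<integral>\<^sup>+ s. g (slice_proj i (u \<bullet> i + s) u) * ?Q u * ?J (u \<bullet> i + s) \<partial>lborel) \<partial>lborel)"
    by (intro nn_integral_cong nn_integral_lborel_translate[symmetric]) auto
  also have "\<dots> = (\<integral>\<^sup>+ u. (\<integral>\<^sup>+ s. g (s *\<^sub>R i + u) * ?Q u * ?J (u \<bullet> i + s) \<partial>lborel) \<partial>lborel)"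
    by (simp add: slice_proj_def add.commute)
  also have "\<dots> = (\<integral>\<^sup>+ s. (\<integral>\<^sup>+ u. g (s *\<^sub>R i + u) * ?Q u * ?J (u \<bullet> i + s) \<partial>lborel) \<partial>lborel)"
    by (rule lborel_pair.Fubini') auto
  also have "\<dots> = (\<integral>\<^sup>+ s. (\<integral>\<^sup>+ u. g (s *\<^sub>R i + u) * ?Q ((s *\<^sub>R i + u) - s *\<^sub>R i) * ?J ((s *\<^sub>R i + u) \<bullet> i) \<partial>lborel) \<partial>lborel)"
    using i by (simp add: inner_add_left add.commute)
  also have "\<dots> = (\<integral>\<^sup>+ s. (\<integral>\<^sup>+ v. g v * ?Q (v - s *\<^sub>R i) * ?J (v \<bullet> i) \<partial>lborel) \<partial>lborel)"
    by (intro nn_integral_cong nn_integral_lborel_translate) auto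
  \<comment> \<open>After the translation the condition on coordinate \<open>i\<close> of the cube
    and the condition on the height exchange their roles; now \<open>s\<close> occurs only in an
    interval of length \<open>2 * R\<close>.\<close>
  also have "\<dots> = (\<integral>\<^sup>+ s. (\<integral>\<^sup>+ v. g v * ?Q v * ?J (v \<bullet> i - s) \<partial>lborel) \<partial>lborel)"
  proof -
    have "v - s *\<^sub>R i \<in> cube x R \<and> v \<bullet> i \<in> {x \<bullet> i - R..x \<bullet> i + R} \<longleftrightarrow>
      v \<in> cube x R \<and> v \<bullet> i - s \<in> {x \<bullet> i - R..x \<bullet> i + R}" for v s
    proof -
      have "v - s *\<^sub>R i \<in> cube x R \<longleftrightarrow> \<bar>v \<bullet> i - s - x \<bullet> i\<bar> \<le> R \<and> (\<forall>j\<in>Basis - {i}. \<bar>v \<bullet> j - x \<bullet> j\<bar> \<le> R)"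
        using i by (auto simp: mem_cube inner_diff_left inner_Basis split: if_splits)
      moreover have "v \<in> cube x R \<longleftrightarrow> \<bar>v \<bullet> i - x \<bullet> i\<bar> \<le> R \<and> (\<forall>j\<in>Basis - {i}. \<bar>v \<bullet> j - x \<bullet> j\<bar> \<le> R)"
        using i by (auto simp: mem_cube)
      ultimately show ?thesis by (auto simp: abs_le_iff)
    qed
    then have "g v * ?Q (v - s *\<^sub>R i) * ?J (v \<bullet> i) = g v * ?Q v * ?J (v \<bullet> i - s)" for v s
      by (auto simp: indicator_def)
    then show ?thesis by simp
  qed
  also have "\<dots> = (\<integral>\<^sup>+ v. (\<integral>\<^sup>+ s. g v * ?Q v * ?J (v \<bullet> i - s) \<partial>lborel) \<partial>lborel)"
    by (rule lborel_pair.Fubini') auto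
  also have "\<dots> = (\<integral>\<^sup>+ v. g v * ?Q v * ennreal (2 * R) \<partial>lborel)"
  proof (rule nn_integral_cong)
    fix v
    have "(\<integral>\<^sup>+ s. ?J (v \<bullet> i - s) \<partial>lborel) =
      (\<integral>\<^sup>+ s. indicator {v \<bullet> i - (x \<bullet> i + R)..v \<bullet> i - (x \<bullet> i - R)} s \<partial>lborel)"
      by (intro nn_integral_cong) (auto simp: indicator_def)
    also have "\<dots> = ennreal (2 * R)" using R by simp
    finally show "(\<integral>\<^sup>+ s. g v * ?Q v * ?J (v \<bullet> i - s) \<partial>lborel) = g v * ?Q v * ennreal (2 * R)"
      by (subst nn_integral_cmult) auto
  qed
  also have "\<dots> = ennreal (2 * R) * (\<integral>\<^sup>+ u. g u * ?Q u \<partial>lborel)"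
    by (subst nn_integral_multc) (auto simp: mult.commute)
  finally show ?thesis .
qed

text \<open>Averaging over the slab: one factor 2 comes from \<open>exists_le_average\<close>, the
  factor \<open>2 * R\<close> from the normalization of slice integrals.\<close>

lemma exists_small_slice:
  fixes g :: "'a::euclidean_space \<Rightarrow> ennreal"
  assumes i: "i \<in> Basis" and R: "R > 0" and g [measurable]: "g \<in> borel_measurable borel"
    and ab: "a < b" "{a<..<b} \<subseteq> {x \<bullet> i - R..x \<bullet> i + R}"
    and e: "(\<integral>\<^sup>+ u. g u \<partial>lborel) \<le> ennreal e" "e > 0"
  shows "\<exists>t\<in>{a<..<b}. (\<integral>\<^sup>+ u \<in> cube x R. g (slice_proj i t u) \<partial>lborel) \<le> ennreal (4 * R * e / (b - a))"
proof -
  have "(\<integral>\<^sup>+ t \<in> {a<..<b}. (\<integral>\<^sup>+ u \<in> cube x R. g (slice_proj i t u) \<partial>lborel) \<partial>lborel) \<le>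
    (\<integral>\<^sup>+ t \<in> {x \<bullet> i - R..x \<bullet> i + R}. (\<integral>\<^sup>+ u \<in> cube x R. g (slice_proj i t u) \<partial>lborel) \<partial>lborel)"
    using ab by (intro nn_integral_mono) (auto simp: indicator_def)
  also have "\<dots> = ennreal (2 * R) * (\<integral>\<^sup>+ u \<in> cube x R. g u \<partial>lborel)"
    using i R g by (intro nn_integral_slices) auto
  also have "\<dots> \<le> ennreal (2 * R) * (\<integral>\<^sup>+ u. g u \<partial>lborel)"
    by (intro mult_left_mono nn_integral_mono) (auto simp: indicator_def)
  also have "\<dots> \<le> ennreal (2 * R) * ennreal e" using e by (intro mult_left_mono) auto
  also have "\<dots> = ennreal (2 * R * e)" using R e by (simp add: ennreal_mult)
  finally have "(\<integral>\<^sup>+ t \<in> {a<..<b}. (\<integral>\<^sup>+ u \<in> cube x R. g (slice_proj i t u) \<partial>lborel) \<partial>lborel) \<le> \<dots>" .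
  then have "\<exists>t\<in>{a<..<b}. (\<integral>\<^sup>+ u \<in> cube x R. g (slice_proj i t u) \<partial>lborel) \<le> ennreal (2 * (2 * R * e) / (b - a))"
    using ab R e by (intro exists_le_average[where M = lborel]) auto
  then show ?thesis by (simp add: mult.assoc)
qed

text \<open>The contraction of the slice towards \<open>c\<close> is induced by an affine map of the
  cube that fixes coordinate \<open>i\<close> and shrinks the others. Its determinant is
  \<open>s\<close> to the power n - 1 rather than n, and this gain of one dimension is what Morrey's
  estimate rests on.\<close>

lemma nn_integral_slice_contract:
  fixes G :: "'a::euclidean_space \<Rightarrow> ennreal"
  assumes i: "i \<in> Basis" and [measurable]: "G \<in> borel_measurable borel"
    and c: "c \<in> cube x R" "c \<bullet> i = t" and s: "0 < s" "s \<le> 1"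
  shows "(\<integral>\<^sup>+ u \<in> cube x R. G (c + s *\<^sub>R (slice_proj i t u - c)) \<partial>lborel) \<le>
    ennreal (s powr - (real DIM('a) - 1)) * (\<integral>\<^sup>+ u \<in> cube x R. G (slice_proj i t u) \<partial>lborel)"
proof -
  \<comment> \<open>\<open>k\<close> holds the diagonal entries of this affine map \<open>A\<close>,
    and \<open>T\<close> its translation part.\<close>
  define k where "k = (\<lambda>j. if j = i then 1 else s)"
  define T where "T = (\<Sum>j\<in>Basis. ((1 - k j) * (c \<bullet> j)) *\<^sub>R j)"
  define A where "A = (\<lambda>u. T + (\<Sum>j\<in>Basis. (k j * (u \<bullet> j)) *\<^sub>R j))"
  have T_inner: "T \<bullet> j = (1 - k j) * (c \<bullet> j)" if "j \<in> Basis" for j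
    using that by (simp add: T_def)
  have A_inner: "A u \<bullet> j = (if j = i then u \<bullet> j else c \<bullet> j + s * (u \<bullet> j - c \<bullet> j))" if "j \<in> Basis" for u j
    proof -
    have "A u \<bullet> j = T \<bullet> j + k j * (u \<bullet> j)" using that by (simp add: A_def inner_add_left)
    also have "\<dots> = (1 - k j) * (c \<bullet> j) + k j * (u \<bullet> j)" by (simp only: T_inner[OF that])
    also have "\<dots> = (if j = i then u \<bullet> j else c \<bullet> j + s * (u \<bullet> j - c \<bullet> j))"
      by (simp add: k_def left_diff_distrib right_diff_distrib)
    finally show ?thesis .
  qed
  have A_meas [measurable]: "A \<in> borel \<rightarrow>\<^sub>M borel" unfolding A_def by measurable
  have "slice_proj i t (A u) = c + s *\<^sub>R (slice_proj i t u - c)" for u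
  proof (rule euclidean_eqI)
    fix j :: 'a assume j: "j \<in> Basis"
    show "slice_proj i t (A u) \<bullet> j = (c + s *\<^sub>R (slice_proj i t u - c)) \<bullet> j"
      using i j c(2) by (cases "j = i")
        (simp_all add: slice_proj_inner A_inner inner_add_left inner_diff_left)
  qed
  then have 1: "G (c + s *\<^sub>R (slice_proj i t u - c)) = G (slice_proj i t (A u))" for u by simp
  have 2: "A u \<in> cube x R" if u: "u \<in> cube x R" for u
    unfolding mem_cube
  proof
    fix j :: 'a assume j: "j \<in> Basis"
    have "\<bar>c \<bullet> j + s * (u \<bullet> j - c \<bullet> j) - x \<bullet> j\<bar> = \<bar>(1 - s) * (c \<bullet> j - x \<bullet> j) + s * (u \<bullet> j - x \<bullet> j)\<bar>"
      by (simp add: algebra_simps)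
    also have "\<dots> \<le> (1 - s) * \<bar>c \<bullet> j - x \<bullet> j\<bar> + s * \<bar>u \<bullet> j - x \<bullet> j\<bar>"
      using s by (intro order_trans[OF abs_triangle_ineq]) (simp add: abs_mult)
    also have "\<dots> \<le> (1 - s) * R + s * R"
      using s c u j by (intro add_mono mult_left_mono) (auto simp: mem_cube)
    finally show "\<bar>A u \<bullet> j - x \<bullet> j\<bar> \<le> R" using u j by (auto simp: A_inner mem_cube algebra_simps)
  qed
  have prod: "(\<Prod>j\<in>(Basis :: 'a set). \<bar>k j\<bar>) = s powr (real DIM('a) - 1)"
  proof -
    have "(\<Prod>j\<in>(Basis :: 'a set). \<bar>k j\<bar>) = \<bar>k i\<bar> * (\<Prod>j\<in>Basis - {i}. \<bar>k j\<bar>)"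
      using i by (subst prod.remove[of _ i]) auto
    also have "\<dots> = (\<Prod>j\<in>Basis - {i}. s)" using s by (auto simp: k_def intro!: prod.cong)
    also have "\<dots> = s ^ (DIM('a) - 1)" using i by simp
    also have "\<dots> = s powr (real DIM('a) - 1)"
      using s by (simp add: powr_realpow[symmetric] of_nat_diff Suc_leI)
    finally show ?thesis .
  qed
  let ?h = "\<lambda>v. G (slice_proj i t v) * indicator (cube x R) v"
  have "(\<integral>\<^sup>+ v. ?h v \<partial>lborel) = ennreal (s powr (real DIM('a) - 1)) * (\<integral>\<^sup>+ u. ?h (A u) \<partial>lborel)"
    using s unfolding prod[symmetric] A_def
    by (subst lborel_affine_euclidean[of k T])
      (auto simp: k_def nn_integral_density nn_integral_distr nn_integral_cmult)
  then have "ennreal (s powr - (real DIM('a) - 1)) * (\<integral>\<^sup>+ v. ?h v \<partial>lborel) =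
      ennreal (s powr - (real DIM('a) - 1) * s powr (real DIM('a) - 1)) * (\<integral>\<^sup>+ u. ?h (A u) \<partial>lborel)"
    by (simp add: ennreal_mult mult.assoc)
  also have "s powr - (real DIM('a) - 1) * s powr (real DIM('a) - 1) = 1"
    using s by (simp flip: powr_add)
  finally have "(\<integral>\<^sup>+ u. ?h (A u) \<partial>lborel) = ennreal (s powr - (real DIM('a) - 1)) * (\<integral>\<^sup>+ v. ?h v \<partial>lborel)"
    by simp
  moreover have "(\<integral>\<^sup>+ u \<in> cube x R. G (c + s *\<^sub>R (slice_proj i t u - c)) \<partial>lborel) \<le> (\<integral>\<^sup>+ u. ?h (A u) \<partial>lborel)"
    using 1 2 by (intro nn_integral_mono) (auto simp: indicator_def)
  ultimately show ?thesis by simp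
qed

lemma nn_integral_powr_unit:
  assumes "a > -1"
  shows "(\<integral>\<^sup>+ s \<in> {0..1}. ennreal (s powr a) \<partial>lborel) = ennreal (1 / (a + 1))"
proof -
  have "((\<lambda>s. s powr a) has_integral 1 / (a + 1)) {0..1}"
    using has_integral_powr_from_0[OF assms, of 1] by simp
  from nn_integral_has_integral_lebesgue[OF _ this]
  have "(\<integral>\<^sup>+ s. ennreal (indicator {0..1} s * (s powr a)) \<partial>lborel) = ennreal (1 / (a + 1))"
    by simp
  then show ?thesis
    by (simp add: ennreal_mult' ennreal_indicator mult.commute)
qed

text \<open>The weight \<open>s powr - \<alpha>\<close> in Young's inequality has to be integrable near 0, and so has the
  weight \<open>s powr (\<alpha> * (p - 1) - (n - 1))\<close> that the contraction of the (n-1)-dimensional slice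
  leaves on the other term. Such an \<open>\<alpha>\<close> exists because p > n - 1.\<close>

lemma slice_segment_cost_bound:
  fixes c :: "'a::euclidean_space" and p :: real
  assumes n: "DIM('a) \<ge> 2" and p: "p > real DIM('a) - 1"
  shows "\<exists>A>0. \<exists>B>0. \<forall>\<rho> x R i (c :: 'a) l. \<rho> \<in> borel_measurable borel \<longrightarrow> i \<in> Basis \<longrightarrow>
      c \<in> cube x R \<longrightarrow> R > 0 \<longrightarrow> l > 0 \<longrightarrow>
      (\<integral>\<^sup>+ u \<in> cube x R. segment_cost \<rho> c (slice_proj i (c \<bullet> i) u) \<partial>lborel) \<le>
        ennreal (2 * real DIM('a) * R) * (ennreal (l * A * (2 * R) ^ DIM('a)) +
          ennreal (l powr (1 - p) * B) *
          (\<integral>\<^sup>+ u \<in> cube x R. ennreal_powr (\<rho> (slice_proj i (c \<bullet> i) u)) p \<partial>lborel))"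
proof -
  define N where "N = real DIM('a)"
  \<comment> \<open>The midpoint between \<open>(N - 2) / (p - 1)\<close> and 1. Below 1 the weight
    \<open>s powr - \<alpha>\<close> is integrable, above the other end \<open>\<beta>\<close>
    exceeds -1.\<close>
  define \<alpha> where "\<alpha> = ((N - 2) / (p - 1) + 1) / 2"
  define \<beta> where "\<beta> = \<alpha> * (p - 1) - (N - 1)"
  have N: "N \<ge> 2" and pN: "p - 1 > N - 2" using n p by (auto simp: N_def)
  then have p1: "p > 1" by simp
  have \<alpha>: "- \<alpha> > -1" using pN p1 by (simp add: \<alpha>_def field_simps)
  have "\<alpha> * (p - 1) = ((N - 2) + (p - 1)) / 2" using p1 by (simp add: \<alpha>_def field_simps)
  then have \<beta>: "\<beta> > -1" using pN by (simp add: \<beta>_def)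
  define A where "A = 1 / (- \<alpha> + 1)"
  define B where "B = 1 / (\<beta> + 1)"
  have AB: "A > 0" "B > 0" using \<alpha> \<beta> by (auto simp: A_def B_def)
  have main: "(\<integral>\<^sup>+ u \<in> cube x R. segment_cost \<rho> c (slice_proj i t u) \<partial>lborel) \<le>
        ennreal (2 * real DIM('a) * R) * (ennreal (l * A * (2 * R) ^ DIM('a)) +
          ennreal (l powr (1 - p) * B) * (\<integral>\<^sup>+ u \<in> cube x R. ennreal_powr (\<rho> (slice_proj i t u)) p \<partial>lborel))"
    if [measurable]: "\<rho> \<in> borel_measurable borel" and i: "i \<in> Basis" and c: "c \<in> cube x R" "c \<bullet> i = t"
      and R: "R > 0" and l: "l > 0" for \<rho> x R i t l and c :: 'a
  proof -
    define S where "S = (\<integral>\<^sup>+ u \<in> cube x R. ennreal_powr (\<rho> (slice_proj i t u)) p \<partial>lborel)"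
    let ?G = "\<lambda>x. ennreal_powr (\<rho> x) p"
    let ?w = "\<lambda>u s. c + s *\<^sub>R (slice_proj i t u - c)"
    let ?Q = "\<lambda>u. indicator (cube x R) u :: ennreal"
    let ?I = "\<lambda>s. indicator {0..1} s :: ennreal"
    have \<rho>w [measurable]: "(\<lambda>(u, s). \<rho> (?w u s)) \<in> borel_measurable (borel \<Otimes>\<^sub>M borel)"
      by measurable
    have slice: "(\<integral>\<^sup>+ u. \<rho> (?w u s) * ?Q u \<partial>lborel) \<le>
        ennreal (l * (2 * R) ^ DIM('a)) * ennreal (s powr - \<alpha>) +
        ennreal (l powr (1 - p)) * S * ennreal (s powr \<beta>)"
      if s: "0 < s" "s \<le> 1" for s
    proof -
      \<comment> \<open>The level in Young's inequality depends on \<open>s\<close>. Its power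
        \<open>1 - p\<close> contributes \<open>s powr (\<alpha> * (p - 1))\<close>, and with the
        factor from the contraction this gives \<open>s powr \<beta>\<close>.\<close>
      define m where "m = l * s powr - \<alpha>"
      have m: "m > 0" using s l by (simp add: m_def)
      have "(\<integral>\<^sup>+ u. \<rho> (?w u s) * ?Q u \<partial>lborel) \<le>
        (\<integral>\<^sup>+ u. ennreal m * ?Q u + ennreal (m powr (1 - p)) * (?G (?w u s) * ?Q u) \<partial>lborel)"
        using ennreal_le_add_powr[OF m, of p] p1
        by (intro nn_integral_mono) (auto simp: indicator_def)
      also have "\<dots> = ennreal m * emeasure lborel (cube x R) +
          ennreal (m powr (1 - p)) * (\<integral>\<^sup>+ u. ?G (?w u s) * ?Q u \<partial>lborel)"
        by (subst nn_integral_add) (auto simp: nn_integral_cmult nn_integral_cmult_indicator)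
      also have "\<dots> \<le> ennreal m * ennreal ((2 * R) ^ DIM('a)) +
          ennreal (m powr (1 - p)) * (ennreal (s powr - (N - 1)) * S)"
      proof -
        have "emeasure lborel (cube x R) = ennreal ((2 * R) ^ DIM('a))"
          by (rule emeasure_cube) (use R in simp)
        moreover have "(\<integral>\<^sup>+ u. ?G (?w u s) * ?Q u \<partial>lborel) \<le> ennreal (s powr - (N - 1)) * S"
          unfolding S_def N_def by (rule nn_integral_slice_contract) (use i c s in auto)
        ultimately show ?thesis by (simp add: add_left_mono mult_left_mono)
      qed
      also have "ennreal m * ennreal ((2 * R) ^ DIM('a)) = ennreal (l * (2 * R) ^ DIM('a)) * ennreal (s powr - \<alpha>)"
        using l R s by (simp add: m_def mult_ac flip: ennreal_mult)
      also have "ennreal (m powr (1 - p)) * (ennreal (s powr - (N - 1)) * S) =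
          ennreal (l powr (1 - p)) * S * ennreal (s powr \<beta>)"
      proof -
        have "m powr (1 - p) * s powr - (N - 1) = l powr (1 - p) * s powr \<beta>"
          using l s by (simp add: m_def powr_mult powr_powr \<beta>_def algebra_simps flip: powr_add)
        then have "ennreal (m powr (1 - p)) * ennreal (s powr - (N - 1)) =
          ennreal (l powr (1 - p)) * ennreal (s powr \<beta>)"
          by (simp flip: ennreal_mult)
        then show ?thesis by (simp add: mult_ac)
      qed
      finally show ?thesis .
    qed
    have "(\<integral>\<^sup>+ u. segment_cost \<rho> c (slice_proj i t u) * ?Q u \<partial>lborel) \<le>
      (\<integral>\<^sup>+ u. ennreal (2 * N * R) * (\<integral>\<^sup>+ s. \<rho> (?w u s) * ?I s * ?Q u \<partial>lborel) \<partial>lborel)"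
    proof (rule nn_integral_mono)
      fix u
      show "segment_cost \<rho> c (slice_proj i t u) * ?Q u \<le>
        ennreal (2 * N * R) * (\<integral>\<^sup>+ s. \<rho> (?w u s) * ?I s * ?Q u \<partial>lborel)"
      proof (cases "u \<in> cube x R")
        case True
        have "slice_proj i t u \<in> cube x R"
          using c i True by (intro slice_proj_in_cube) (auto simp: mem_cube)
        then have "dist c (slice_proj i t u) \<le> 2 * N * R"
          using dist_cube_le[OF c(1)] by (simp add: N_def mult_ac)
        then show ?thesis using True by (auto simp: segment_cost_def intro!: mult_right_mono ennreal_leI)
      qed simp
    qed
    also have "\<dots> = ennreal (2 * N * R) * (\<integral>\<^sup>+ u. (\<integral>\<^sup>+ s. \<rho> (?w u s) * ?I s * ?Q u \<partial>lborel) \<partial>lborel)"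
      by (rule nn_integral_cmult) measurable
    also have "(\<integral>\<^sup>+ u. (\<integral>\<^sup>+ s. \<rho> (?w u s) * ?I s * ?Q u \<partial>lborel) \<partial>lborel) =
        (\<integral>\<^sup>+ s. (\<integral>\<^sup>+ u. \<rho> (?w u s) * ?I s * ?Q u \<partial>lborel) \<partial>lborel)"
      by (rule lborel_pair.Fubini') measurable
    also have "\<dots> \<le> (\<integral>\<^sup>+ s. ennreal (l * (2 * R) ^ DIM('a)) * (ennreal (s powr - \<alpha>) * ?I s) +
        ennreal (l powr (1 - p)) * S * (ennreal (s powr \<beta>) * ?I s) \<partial>lborel)"
    \<comment> \<open>At \<open>s = 0\<close> the contraction degenerates and
      \<open>0 powr - \<alpha>\<close> is 0, so the bound is claimed only almost everywhere.\<close>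
    proof (rule nn_integral_mono_AE)
      have "AE s in lborel. s \<noteq> (0::real)" by (rule AE_lborel_singleton)
      then show "AE s in lborel. (\<integral>\<^sup>+ u. \<rho> (?w u s) * ?I s * ?Q u \<partial>lborel) \<le>
        ennreal (l * (2 * R) ^ DIM('a)) * (ennreal (s powr - \<alpha>) * ?I s) +
        ennreal (l powr (1 - p)) * S * (ennreal (s powr \<beta>) * ?I s)"
      proof eventually_elim
        case (elim s)
        show ?case
        proof (cases "s \<in> {0..1}")
          case True
          then show ?thesis using slice[of s] elim by simp
        qed simp
      qed
    qed
    also have "\<dots> = ennreal (l * (2 * R) ^ DIM('a)) * ennreal A + ennreal (l powr (1 - p)) * S * ennreal B"
      using nn_integral_powr_unit[OF \<alpha>] nn_integral_powr_unit[OF \<beta>]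
      by (subst nn_integral_add) (auto simp: nn_integral_cmult A_def B_def)
    also have "\<dots> = ennreal (l * A * (2 * R) ^ DIM('a)) + ennreal (l powr (1 - p) * B) * S"
      using AB l R by (simp add: ennreal_mult mult_ac)
    finally show ?thesis by (simp add: N_def S_def mult_left_mono)
  qed
  show ?thesis using AB main by blast
qed

text \<open>A single slice that is good for both sets avoids any measurable selection of points.\<close>

lemma connect_across_slices:
  fixes x :: "'a::euclidean_space" and p :: real
  assumes n: "DIM('a) \<ge> 2" and p: "p > real DIM('a) - 1" and pos: "R > 0" "\<tau> > 0" "\<eta> > 0"
  shows "\<exists>\<epsilon>>0. \<forall>\<rho> i a b C C'. \<rho> \<in> borel_measurable borel \<longrightarrow>
      (\<integral>\<^sup>+ x. ennreal_powr (\<rho> x) p \<partial>lborel) \<le> ennreal \<epsilon> \<longrightarrow>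
      i \<in> Basis \<longrightarrow> \<tau> \<le> b - a \<longrightarrow> {a<..<b} \<subseteq> {x \<bullet> i - R..x \<bullet> i + R} \<longrightarrow>
      (\<forall>t\<in>{a<..<b}. \<exists>c\<in>C \<inter> cube x R. c \<bullet> i = t) \<longrightarrow>
      (\<forall>t\<in>{a<..<b}. \<exists>c\<in>C' \<inter> cube x R. c \<bullet> i = t) \<longrightarrow>
      (\<exists>c\<in>C \<inter> cube x R. \<exists>c'\<in>C' \<inter> cube x R. \<exists>w\<in>cube x R.
        segment_cost \<rho> c w + segment_cost \<rho> c' w \<le> ennreal \<eta>)"
proof -
  obtain A B where AB: "A > 0" "B > 0" and bound:
    "\<forall>\<rho> x R i (c :: 'a) l. \<rho> \<in> borel_measurable borel \<longrightarrow> i \<in> Basis \<longrightarrow>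
      c \<in> cube x R \<longrightarrow> R > 0 \<longrightarrow> l > 0 \<longrightarrow>
      (\<integral>\<^sup>+ u \<in> cube x R. segment_cost \<rho> c (slice_proj i (c \<bullet> i) u) \<partial>lborel) \<le>
        ennreal (2 * real DIM('a) * R) * (ennreal (l * A * (2 * R) ^ DIM('a)) +
          ennreal (l powr (1 - p) * B) *
          (\<integral>\<^sup>+ u \<in> cube x R. ennreal_powr (\<rho> (slice_proj i (c \<bullet> i) u)) p \<partial>lborel))"
    using slice_segment_cost_bound[OF n p] by blast
  define N where "N = real DIM('a)"
  have N: "N > 0" using n by (simp add: N_def)
  define m where "m = (2 * R) ^ DIM('a)"
  have m: "m > 0" using pos by (simp add: m_def)
  \<comment> \<open>\<open>l\<close> makes the energy-free term of the final average equal to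
    \<open>\<eta> / 2\<close>. Only then is \<open>\<epsilon>\<close> chosen to do the same for the
    energy term, whose coefficient \<open>k\<close> contains \<open>l powr (1 - p)\<close>.\<close>
  define l where "l = \<eta> / (16 * N * R * A)"
  have l: "l > 0" using pos N AB by (simp add: l_def)
  define k where "k = l powr (1 - p) * B"
  have k: "k > 0" using l AB by (simp add: k_def)
  define \<epsilon> where "\<epsilon> = (\<eta> * m * \<tau>) / (64 * N * R * R * k)"
  have \<epsilon>: "\<epsilon> > 0" using pos N m k by (simp add: \<epsilon>_def)
  have main: "\<exists>c\<in>C \<inter> cube x R. \<exists>c'\<in>C' \<inter> cube x R. \<exists>w\<in>cube x R.
        segment_cost \<rho> c w + segment_cost \<rho> c' w \<le> ennreal \<eta>"
    if \<rho> [measurable]: "\<rho> \<in> borel_measurable borel" and I: "(\<integral>\<^sup>+ x. ennreal_powr (\<rho> x) p \<partial>lborel) \<le> ennreal \<epsilon>"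
      and i: "i \<in> Basis" and ab: "\<tau> \<le> b - a" "{a<..<b} \<subseteq> {x \<bullet> i - R..x \<bullet> i + R}"
      and C: "\<forall>t\<in>{a<..<b}. \<exists>c\<in>C \<inter> cube x R. c \<bullet> i = t"
      and C': "\<forall>t\<in>{a<..<b}. \<exists>c\<in>C' \<inter> cube x R. c \<bullet> i = t" for \<rho> i a b C C'
  proof -
    have "\<exists>t\<in>{a<..<b}. (\<integral>\<^sup>+ u \<in> cube x R. ennreal_powr (\<rho> (slice_proj i t u)) p \<partial>lborel) \<le>
        ennreal (4 * R * \<epsilon> / (b - a))"
      using i pos ab I \<epsilon> by (intro exists_small_slice) auto
    then obtain t where t: "t \<in> {a<..<b}" and
      "(\<integral>\<^sup>+ u \<in> cube x R. ennreal_powr (\<rho> (slice_proj i t u)) p \<partial>lborel) \<le> ennreal (4 * R * \<epsilon> / (b - a))"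
      by blast
    note this(2)
    also have "ennreal (4 * R * \<epsilon> / (b - a)) \<le> ennreal (4 * R * \<epsilon> / \<tau>)"
      using pos \<epsilon> ab by (intro ennreal_leI divide_left_mono) auto
    finally have S: "(\<integral>\<^sup>+ u \<in> cube x R. ennreal_powr (\<rho> (slice_proj i t u)) p \<partial>lborel) \<le> \<dots>" .
    define K where "K = 2 * N * R * (l * A * m + k * (4 * R * \<epsilon> / \<tau>))"
    have K: "K > 0" using pos N l AB m k \<epsilon> by (simp add: K_def add_pos_pos)
    have le: "(\<integral>\<^sup>+ u \<in> cube x R. segment_cost \<rho> c (slice_proj i t u) \<partial>lborel) \<le> ennreal K"
      if c: "c \<in> cube x R" "c \<bullet> i = t" for c
    proof -
      have "(\<integral>\<^sup>+ u \<in> cube x R. segment_cost \<rho> c (slice_proj i t u) \<partial>lborel) \<le>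
        ennreal (2 * N * R) * (ennreal (l * A * m) +
          ennreal k * (\<integral>\<^sup>+ u \<in> cube x R. ennreal_powr (\<rho> (slice_proj i t u)) p \<partial>lborel))"
        using bound[rule_format, OF \<rho> i c(1) pos(1) l] c(2) by (simp add: N_def m_def k_def)
      also have "\<dots> \<le> ennreal (2 * N * R) * (ennreal (l * A * m) + ennreal k * ennreal (4 * R * \<epsilon> / \<tau>))"
        by (intro mult_left_mono add_left_mono S) auto
      also have "\<dots> = ennreal K"
        unfolding K_def using pos N l AB m k \<epsilon>
        by (simp del: ennreal_plus times_divide_eq_right flip: ennreal_plus ennreal_mult)
      finally show ?thesis .
    qed
    obtain c where c: "c \<in> C \<inter> cube x R" "c \<bullet> i = t" using C t by blast
    obtain c' where c': "c' \<in> C' \<inter> cube x R" "c' \<bullet> i = t" using C' t by blast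
    \<comment> \<open>Averaging the sum of both costs yields a single third point that serves
      \<open>c\<close> and \<open>c'\<close> at once.\<close>
    let ?h = "\<lambda>u. segment_cost \<rho> c (slice_proj i t u) + segment_cost \<rho> c' (slice_proj i t u)"
    have meas [measurable]: "(\<lambda>u. segment_cost \<rho> c (slice_proj i t u)) \<in> borel_measurable borel" for c
      unfolding segment_cost_def by measurable
    have "(\<integral>\<^sup>+ u \<in> cube x R. ?h u \<partial>lborel) =
      (\<integral>\<^sup>+ u \<in> cube x R. segment_cost \<rho> c (slice_proj i t u) \<partial>lborel) +
      (\<integral>\<^sup>+ u \<in> cube x R. segment_cost \<rho> c' (slice_proj i t u) \<partial>lborel)"
      by (simp add: distrib_right nn_integral_add)
    also have "\<dots> \<le> ennreal K + ennreal K" using c c' by (intro add_mono le) auto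
    also have "\<dots> = ennreal (2 * K)" using K by (simp flip: ennreal_plus)
    finally have "\<exists>u\<in>cube x R. ?h u \<le> ennreal (2 * (2 * K) / m)"
      using m K pos by (intro exists_le_average[where M = lborel]) (auto simp: emeasure_cube m_def)
    then obtain u where u: "u \<in> cube x R" "?h u \<le> ennreal (2 * (2 * K) / m)" by blast
    have "2 * (2 * K) / m = 8 * N * R * A * l + 32 * N * R * R * k * \<epsilon> / (\<tau> * m)"
      using m pos by (simp add: K_def field_simps)
    also have "8 * N * R * A * l = \<eta> / 2" using pos N AB by (simp add: l_def field_simps)
    also have "32 * N * R * R * k * \<epsilon> / (\<tau> * m) = \<eta> / 2"
      using pos N m k by (simp add: \<epsilon>_def field_simps)
    finally have "?h u \<le> ennreal \<eta>" using u by simp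
    moreover have "slice_proj i t u \<in> cube x R"
      using i t ab u by (intro slice_proj_in_cube) (auto simp: abs_le_iff subset_iff)
    ultimately show ?thesis using c c' by blast
  qed
  show ?thesis using \<epsilon> main by blast
qed

text \<open>Averaged over the centres \<open>z\<close>, the integral of \<rho> along an arm is at
  most \<open>2 * L\<close> times its integral over the larger cube, because every translate of the
  small cube along the arm stays inside that cube. Summing over the directions before averaging
  gives one centre for all of them.\<close>

lemma exists_cheap_cross:
  fixes x :: "'a::euclidean_space" and p :: real
  assumes p: "p \<ge> 1" and pos: "r > 0" "L > 0" "r + L \<le> R" "\<eta> > 0"
  shows "\<exists>\<epsilon>>0. \<forall>\<rho>. \<rho> \<in> borel_measurable borel \<longrightarrow>
      (\<integral>\<^sup>+ x. ennreal_powr (\<rho> x) p \<partial>lborel) \<le> ennreal \<epsilon> \<longrightarrow>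
      (\<exists>z\<in>cube x r. \<forall>k\<in>Basis. (\<integral>\<^sup>+ s \<in> {-L..L}. \<rho> (z + s *\<^sub>R k) \<partial>lborel) \<le> ennreal \<eta>)"
proof -
  have R: "R > 0" using pos by simp
  define N where "N = real DIM('a)"
  have N: "N > 0" by (simp add: N_def)
  define m where "m = (2 * R) ^ DIM('a)"
  define q where "q = (2 * r) ^ DIM('a)"
  have m: "m > 0" "q > 0" using pos R by (auto simp: m_def q_def)
  \<comment> \<open>As in the slice estimate, \<open>l\<close> and then \<open>\<epsilon>\<close>
    are chosen so that each of the two terms of the average equals
    \<open>\<eta> / 2\<close>.\<close>
  define l where "l = \<eta> * q / (8 * N * L * m)"
  have l: "l > 0" using pos m N by (simp add: l_def)
  define k where "k = l powr (1 - p)"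
  have k: "k > 0" using l by (simp add: k_def)
  define \<epsilon> where "\<epsilon> = \<eta> * q / (8 * N * L * k)"
  have \<epsilon>: "\<epsilon> > 0" using pos m N k by (simp add: \<epsilon>_def)
  define K where "K = 2 * L * (l * m + k * \<epsilon>)"
  have K: "K > 0" using pos l m k \<epsilon> by (simp add: K_def add_pos_pos)
  have main: "\<exists>z\<in>cube x r. \<forall>k\<in>Basis. (\<integral>\<^sup>+ s \<in> {-L..L}. \<rho> (z + s *\<^sub>R k) \<partial>lborel) \<le> ennreal \<eta>"
    if \<rho> [measurable]: "\<rho> \<in> borel_measurable borel" and I: "(\<integral>\<^sup>+ x. ennreal_powr (\<rho> x) p \<partial>lborel) \<le> ennreal \<epsilon>" for \<rho>
  proof -
    have "(\<integral>\<^sup>+ v \<in> cube x R. \<rho> v \<partial>lborel) \<le>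
      (\<integral>\<^sup>+ v. ennreal l * indicator (cube x R) v + ennreal k * ennreal_powr (\<rho> v) p \<partial>lborel)"
      using ennreal_le_add_powr[OF l p] by (intro nn_integral_mono) (auto simp: indicator_def k_def)
    also have "\<dots> = ennreal l * emeasure lborel (cube x R) + ennreal k * (\<integral>\<^sup>+ v. ennreal_powr (\<rho> v) p \<partial>lborel)"
      by (subst nn_integral_add) (auto simp: nn_integral_cmult nn_integral_cmult_indicator)
    also have "\<dots> \<le> ennreal l * ennreal m + ennreal k * ennreal \<epsilon>"
      using R I by (intro add_mono mult_left_mono) (auto simp: emeasure_cube m_def)
    also have "\<dots> = ennreal (l * m + k * \<epsilon>)" using l m k \<epsilon> by (simp add: ennreal_mult ennreal_plus)
    finally have big: "(\<integral>\<^sup>+ v \<in> cube x R. \<rho> v \<partial>lborel) \<le> \<dots>" .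
    have one: "(\<integral>\<^sup>+ z \<in> cube x r. (\<integral>\<^sup>+ s \<in> {-L..L}. \<rho> (z + s *\<^sub>R i) \<partial>lborel) \<partial>lborel) \<le> ennreal K"
      if i: "i \<in> Basis" for i
    proof -
      have "(\<integral>\<^sup>+ z. (\<integral>\<^sup>+ s. \<rho> (z + s *\<^sub>R i) * indicator {-L..L} s \<partial>lborel) * indicator (cube x r) z \<partial>lborel) =
        (\<integral>\<^sup>+ z. (\<integral>\<^sup>+ s. \<rho> (z + s *\<^sub>R i) * indicator {-L..L} s * indicator (cube x r) z \<partial>lborel) \<partial>lborel)"
        by (subst nn_integral_multc[symmetric]) auto
      also have "\<dots> =
        (\<integral>\<^sup>+ s. (\<integral>\<^sup>+ z. \<rho> (z + s *\<^sub>R i) * indicator {-L..L} s * indicator (cube x r) z \<partial>lborel) \<partial>lborel)"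
        by (rule lborel_pair.Fubini') measurable
      also have "\<dots> \<le> (\<integral>\<^sup>+ s. ennreal (l * m + k * \<epsilon>) * indicator {-L..L} s \<partial>lborel)"
      proof (rule nn_integral_mono)
        fix s :: real
        show "(\<integral>\<^sup>+ z. \<rho> (z + s *\<^sub>R i) * indicator {-L..L} s * indicator (cube x r) z \<partial>lborel) \<le>
          ennreal (l * m + k * \<epsilon>) * indicator {-L..L} s"
        proof (cases "s \<in> {-L..L}")
          case True
          have sub: "s *\<^sub>R i + z \<in> cube x R" if z: "z \<in> cube x r" for z
            unfolding mem_cube
          proof
            fix j :: 'a assume j: "j \<in> Basis"
            have "\<bar>z \<bullet> j - x \<bullet> j\<bar> \<le> r" using z j by (simp add: mem_cube)
            then show "\<bar>(s *\<^sub>R i + z) \<bullet> j - x \<bullet> j\<bar> \<le> R"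
              using True pos i j by (auto simp: inner_add_left inner_Basis abs_le_iff)
          qed
          have "(\<integral>\<^sup>+ z. \<rho> (z + s *\<^sub>R i) * indicator {-L..L} s * indicator (cube x r) z \<partial>lborel) \<le>
            (\<integral>\<^sup>+ z. \<rho> (s *\<^sub>R i + z) * indicator (cube x R) (s *\<^sub>R i + z) \<partial>lborel)"
            using sub True by (intro nn_integral_mono) (auto simp: indicator_def add.commute)
          also have "\<dots> = (\<integral>\<^sup>+ v. \<rho> v * indicator (cube x R) v \<partial>lborel)"
            by (rule nn_integral_lborel_translate) measurable
          also have "\<dots> \<le> ennreal (l * m + k * \<epsilon>)" by (rule big)
          finally show ?thesis using True by simp
        qed simp
      qed
      also have "\<dots> = ennreal K"
        using pos l m k \<epsilon>
        by (subst nn_integral_cmult_indicator) (simp_all add: K_def mult_ac del: ennreal_plus flip: ennreal_mult)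
      finally show ?thesis .
    qed
    let ?h = "\<lambda>z. \<Sum>i\<in>Basis. (\<integral>\<^sup>+ s \<in> {-L..L}. \<rho> (z + s *\<^sub>R i) \<partial>lborel)"
    have "(\<integral>\<^sup>+ z \<in> cube x r. ?h z \<partial>lborel) =
      (\<Sum>i\<in>Basis. (\<integral>\<^sup>+ z \<in> cube x r. (\<integral>\<^sup>+ s \<in> {-L..L}. \<rho> (z + s *\<^sub>R i) \<partial>lborel) \<partial>lborel))"
      unfolding sum_distrib_right by (rule nn_integral_sum) measurable
    also have "\<dots> \<le> (\<Sum>i\<in>(Basis :: 'a set). ennreal K)" by (intro sum_mono one)
    also have "\<dots> = ennreal (N * K)" using N K by (simp add: N_def ennreal_of_nat_eq_real_of_nat ennreal_mult)
    finally have "\<exists>z\<in>cube x r. ?h z \<le> ennreal (2 * (N * K) / q)"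
      using m K pos N by (intro exists_le_average[where M = lborel]) (auto simp: emeasure_cube q_def)
    then obtain z where z: "z \<in> cube x r" "?h z \<le> ennreal (2 * (N * K) / q)" by blast
    have "2 * (N * K) / q = 4 * N * L * l * m / q + 4 * N * L * k * \<epsilon> / q"
      using m by (simp add: K_def field_simps)
    also have "4 * N * L * l * m / q = \<eta> / 2" using pos N m by (simp add: l_def field_simps)
    also have "4 * N * L * k * \<epsilon> / q = \<eta> / 2" using pos N m k by (simp add: \<epsilon>_def field_simps)
    finally have z2: "?h z \<le> ennreal \<eta>" using z by simp
    have "(\<integral>\<^sup>+ s \<in> {-L..L}. \<rho> (z + s *\<^sub>R i) \<partial>lborel) \<le> ?h z" if "i \<in> Basis" for i
      using that by (intro member_le_sum) auto
    then show ?thesis using z z2 by (meson order_trans)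
  qed
  show ?thesis using \<epsilon> main by blast
qed

section \<open>Linking continua at low cost\<close>

lemma cube_mono: "r \<le> R \<Longrightarrow> cube x r \<subseteq> cube x R"
  by (force simp: mem_cube)

lemma ball_subset_cube: "ball x r \<subseteq> cube x r"
proof
  fix y assume "y \<in> ball x r"
  then have "norm (y - x) < r" by (simp add: dist_norm norm_minus_commute)
  then show "y \<in> cube x r"
    by (auto simp: mem_cube simp flip: inner_diff_left intro: order_trans[OF Basis_le_norm])
qed

lemma cube_subset_open:
  assumes "open D" "x \<in> D"
  shows "\<exists>R>0. cube x R \<subseteq> D"
proof -
  obtain e where e: "e > 0" "ball x e \<subseteq> D" using assms by (meson open_contains_ball)
  define R where "R = e / (4 * real DIM('a))"
  have R: "R > 0" using e by (simp add: R_def)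
  have "cube x R \<subseteq> ball x e"
  proof
    fix y assume "y \<in> cube x R"
    moreover have "x \<in> cube x R" using R by (simp add: mem_cube)
    ultimately have "dist x y \<le> real DIM('a) * (2 * R)" by (intro dist_cube_le[of x x R])
    also have "\<dots> = e / 2" by (simp add: R_def)
    finally show "y \<in> ball x e" using e by simp
  qed
  then show ?thesis using R e by blast
qed

text \<open>Otherwise, in each coordinate and on both sides, \<open>C\<close> misses some height
  between the two cubes. These heights bound a box between the cubes whose frontier \<open>C\<close>
  would have to cross. The width \<open>d - r\<close> of the slab does not depend on
  \<open>C\<close>.\<close>

lemma connected_leaving_cube_meets_slices:
  fixes C :: "'a::euclidean_space set"
  assumes "connected C" "C \<inter> cube x r \<noteq> {}" "\<not> C \<subseteq> cube x d" "r < d"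
  shows "\<exists>i\<in>Basis. \<exists>a b. b - a = d - r \<and> {a<..<b} \<subseteq> {x \<bullet> i - d..x \<bullet> i + d} \<and>
    (\<forall>t\<in>{a<..<b}. \<exists>c\<in>C \<inter> cube x d. c \<bullet> i = t)"
proof (rule ccontr)
  assume no: "\<not> ?thesis"
  have r: "r \<ge> 0"
  proof -
    obtain c where "c \<in> cube x r" using assms by blast
    then have "\<bar>c \<bullet> (SOME i. i \<in> Basis) - x \<bullet> (SOME i. i \<in> Basis)\<bar> \<le> r" using SOME_Basis by (auto simp: mem_cube)
    then show ?thesis by linarith
  qed
  have no': "\<exists>t\<in>{a<..<b}. \<forall>c\<in>C \<inter> cube x d. c \<bullet> i \<noteq> t"
    if "i \<in> Basis" "b - a = d - r" "{a<..<b} \<subseteq> {x \<bullet> i - d..x \<bullet> i + d}" for i a b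
    using no that by blast
  have "\<exists>t. t \<in> {x \<bullet> i + r<..<x \<bullet> i + d} \<and> (\<forall>c\<in>C \<inter> cube x d. c \<bullet> i \<noteq> t)" if "i \<in> Basis" for i
  proof -
    have "{x \<bullet> i + r<..<x \<bullet> i + d} \<subseteq> {x \<bullet> i - d..x \<bullet> i + d}" using r by auto
    from no'[OF that _ this] show ?thesis by auto
  qed
  then obtain tp where tp: "\<And>i. i \<in> Basis \<Longrightarrow> tp i \<in> {x \<bullet> i + r<..<x \<bullet> i + d}"
    "\<And>i c. i \<in> Basis \<Longrightarrow> c \<in> C \<inter> cube x d \<Longrightarrow> c \<bullet> i \<noteq> tp i" by metis
  have "\<exists>t. t \<in> {x \<bullet> i - d<..<x \<bullet> i - r} \<and> (\<forall>c\<in>C \<inter> cube x d. c \<bullet> i \<noteq> t)" if "i \<in> Basis" for i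
  proof -
    have "{x \<bullet> i - d<..<x \<bullet> i - r} \<subseteq> {x \<bullet> i - d..x \<bullet> i + d}" using r assms(4) by auto
    from no'[OF that _ this] show ?thesis by auto
  qed
  then obtain tm where tm: "\<And>i. i \<in> Basis \<Longrightarrow> tm i \<in> {x \<bullet> i - d<..<x \<bullet> i - r}"
    "\<And>i c. i \<in> Basis \<Longrightarrow> c \<in> C \<inter> cube x d \<Longrightarrow> c \<bullet> i \<noteq> tm i" by metis
  define B where "B = cbox (\<Sum>i\<in>Basis. tm i *\<^sub>R i) (\<Sum>i\<in>Basis. tp i *\<^sub>R i)"
  have B: "y \<in> B \<longleftrightarrow> (\<forall>i\<in>Basis. tm i \<le> y \<bullet> i \<and> y \<bullet> i \<le> tp i)" for y
    by (simp add: B_def mem_box)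
  have "cube x r \<subseteq> B"
    using tp(1) tm(1) unfolding B subset_iff mem_cube by (fastforce simp: abs_le_iff)
  then have 1: "C \<inter> B \<noteq> {}" using assms(2) by blast
  have Bd: "B \<subseteq> cube x d"
    using tp(1) tm(1) unfolding B subset_iff mem_cube by (fastforce simp: abs_le_iff)
  then have "C - B \<noteq> {}" using assms(3) by blast
  from connected_Int_frontier[OF assms(1) 1 this] obtain y where y: "y \<in> C" "y \<in> frontier B" by blast
  then have yB: "y \<in> B" "y \<notin> box (\<Sum>i\<in>Basis. tm i *\<^sub>R i) (\<Sum>i\<in>Basis. tp i *\<^sub>R i)"
    by (auto simp: B_def frontier_cbox)
  then obtain i where i: "i \<in> Basis" "y \<bullet> i = tm i \<or> y \<bullet> i = tp i"
    unfolding B by (force simp: mem_box not_less)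
  then show False using tp(2)[OF i(1), of y] tm(2)[OF i(1), of y] y(1) yB(1) Bd by auto
qed

section \<open>Axis-parallel crosses\<close>

definition cross :: "'a::euclidean_space \<Rightarrow> real \<Rightarrow> 'a set" where
  "cross z L = {z + s *\<^sub>R k | s k. \<bar>s\<bar> \<le> L \<and> k \<in> Basis}"

lemma cross_subset_cube:
  assumes "z \<in> cube x r" "r + L \<le> R" "L \<ge> 0"
  shows "cross z L \<subseteq> cube x R"
proof
  fix y assume "y \<in> cross z L"
  then obtain s k where y: "y = z + s *\<^sub>R k" "\<bar>s\<bar> \<le> L" "k \<in> Basis" by (auto simp: cross_def)
  show "y \<in> cube x R"
    unfolding mem_cube
  proof
    fix j :: 'a assume j: "j \<in> Basis"
    have "\<bar>z \<bullet> j - x \<bullet> j\<bar> \<le> r" using assms(1) j by (simp add: mem_cube)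
    then show "\<bar>y \<bullet> j - x \<bullet> j\<bar> \<le> R"
      using y assms j by (auto simp: inner_add_left inner_Basis abs_le_iff)
  qed
qed

lemma crossI: "\<bar>s\<bar> \<le> L \<Longrightarrow> k \<in> Basis \<Longrightarrow> z + s *\<^sub>R k \<in> cross z L"
  by (auto simp: cross_def)

lemma center_in_cross: "L \<ge> 0 \<Longrightarrow> z \<in> cross z L"
  using crossI[of 0 L "SOME i. i \<in> Basis" z] SOME_Basis by simp

lemma closed_segment_subset_cross:
  assumes "y \<in> cross z L"
  shows "closed_segment z y \<subseteq> cross z L"
proof
  fix w assume w: "w \<in> closed_segment z y"
  obtain s k where y: "y = z + s *\<^sub>R k" "\<bar>s\<bar> \<le> L" "k \<in> Basis"
    using assms by (auto simp: cross_def)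
  obtain u where u: "0 \<le> u" "u \<le> 1" "w = (1 - u) *\<^sub>R z + u *\<^sub>R y"
    using w by (auto simp: closed_segment_def)
  have "w = z + (u * s) *\<^sub>R k" using u y by (simp add: algebra_simps)
  moreover have "\<bar>u * s\<bar> \<le> L"
    using u y(2) mult_left_le_one_le[of "\<bar>s\<bar>" u] by (simp add: abs_mult)
  ultimately show "w \<in> cross z L" using y crossI by metis
qed

lemma connected_cross:
  assumes "L \<ge> 0"
  shows "connected (cross z L)"
proof -
  have "starlike (cross z L)"
    unfolding starlike_def using center_in_cross[OF assms] closed_segment_subset_cross by blast
  then show ?thesis by (rule starlike_imp_connected)
qed

lemma segment_cost_cross:
  fixes z :: "'a::euclidean_space"
  assumes [measurable]: "\<rho> \<in> borel_measurable borel" and k: "k \<in> Basis" and s: "\<bar>s\<bar> \<le> L"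
  shows "segment_cost \<rho> z (z + s *\<^sub>R k) \<le> (\<integral>\<^sup>+ s \<in> {-L..L}. \<rho> (z + s *\<^sub>R k) \<partial>lborel)"
proof (cases "s = 0")
  case False
  have "(\<integral>\<^sup>+ v \<in> {0..1}. \<rho> (z + v *\<^sub>R (z + s *\<^sub>R k - z)) \<partial>lborel) \<le>
    (\<integral>\<^sup>+ v. \<rho> (z + (0 + s * v) *\<^sub>R k) * indicator {-L..L} (0 + s * v) \<partial>lborel)"
  proof (rule nn_integral_mono)
    fix v :: real
    have "s * v \<in> {-L..L}" if "0 \<le> v" "v \<le> 1"
    proof -
      have "\<bar>s * v\<bar> \<le> \<bar>s\<bar>" using that by (simp add: abs_mult mult_left_le)
      then show ?thesis using s by (auto simp: abs_le_iff)
    qed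
    then show "\<rho> (z + v *\<^sub>R (z + s *\<^sub>R k - z)) * indicator {0..1} v \<le>
      \<rho> (z + (0 + s * v) *\<^sub>R k) * indicator {-L..L} (0 + s * v)"
      by (auto simp: indicator_def mult.commute)
  qed
  then have "segment_cost \<rho> z (z + s *\<^sub>R k) \<le>
      ennreal \<bar>s\<bar> * (\<integral>\<^sup>+ v. \<rho> (z + (0 + s * v) *\<^sub>R k) * indicator {-L..L} (0 + s * v) \<partial>lborel)"
    using k by (auto simp: segment_cost_def dist_norm intro: mult_left_mono)
  also have "\<dots> = (\<integral>\<^sup>+ s \<in> {-L..L}. \<rho> (z + s *\<^sub>R k) \<partial>lborel)"
    using False by (intro nn_integral_real_affine[symmetric]) auto
  finally show ?thesis .
qed simp

text \<open>Both points are joined through the centre, hence the factor 2.\<close>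

lemma polygon_cost_within_cross:
  fixes z :: "'a::euclidean_space"
  assumes \<rho>: "\<rho> \<in> borel_measurable borel" and D: "cross z L \<subseteq> D" and L: "L \<ge> 0" and e: "e \<ge> 0"
    and cheap: "\<forall>k\<in>Basis. (\<integral>\<^sup>+ s \<in> {-L..L}. \<rho> (z + s *\<^sub>R k) \<partial>lborel) \<le> ennreal e"
    and ab: "a \<in> cross z L" "b \<in> cross z L"
  shows "\<exists>u. polygon_cost \<rho> D a b u \<and> u \<le> ennreal (2 * e)"
proof -
  have *: "\<exists>u. polygon_cost \<rho> D z y u \<and> u \<le> ennreal e" if y_in: "y \<in> cross z L" for y
  proof -
    obtain s k where y: "y = z + s *\<^sub>R k" "\<bar>s\<bar> \<le> L" "k \<in> Basis" using y_in by (auto simp: cross_def)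
    have "closed_segment z y \<subseteq> cross z L" using y_in by (rule closed_segment_subset_cross)
    then have "polygon_cost \<rho> D z y (segment_cost \<rho> z y)"
      using D by (intro polygon_cost_segment) auto
    moreover have "segment_cost \<rho> z y \<le> ennreal e"
      using segment_cost_cross[OF \<rho> y(3,2), of z] cheap y by (auto intro: order_trans)
    ultimately show ?thesis by blast
  qed
  obtain u v where uv: "polygon_cost \<rho> D z a u" "u \<le> ennreal e" "polygon_cost \<rho> D z b v" "v \<le> ennreal e"
    using * ab by meson
  have "polygon_cost \<rho> D a b (u + v)"
    by (rule polygon_cost_trans[OF uv(3) polygon_cost_sym[OF uv(1) \<rho>]])
  moreover have "u + v \<le> ennreal (2 * e)"
    using add_mono[OF uv(2,4)] e by (simp flip: ennreal_plus)
  ultimately show ?thesis by blast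
qed

section \<open>Linking continua through intermediate continua\<close>

definition sets_within_cost ::
    "('a::euclidean_space \<Rightarrow> ennreal) \<Rightarrow> 'a set \<Rightarrow> real \<Rightarrow> 'a set \<Rightarrow> 'a set \<Rightarrow> bool" where
  "sets_within_cost \<rho> D \<eta> C C' \<longleftrightarrow> (\<exists>a\<in>C. \<exists>b\<in>C'. \<exists>u. polygon_cost \<rho> D a b u \<and> u \<le> ennreal \<eta>)"

lemma sets_within_cost_sym:
  "\<rho> \<in> borel_measurable borel \<Longrightarrow> sets_within_cost \<rho> D \<eta> C C' \<Longrightarrow> sets_within_cost \<rho> D \<eta> C' C"
  unfolding sets_within_cost_def by (meson polygon_cost_sym)

text \<open>The two polygons reach \<open>X\<close> at different points in general;
  \<open>e2\<close> is the price for moving between these inside \<open>D\<close>.\<close>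

lemma sets_within_cost_through:
  assumes \<rho>: "\<rho> \<in> borel_measurable borel" and pos: "e1 \<ge> 0" "e2 \<ge> 0" "e3 \<ge> 0"
    and 1: "sets_within_cost \<rho> D e1 C X" and 3: "sets_within_cost \<rho> D e3 X C'"
    and X: "\<And>a b. a \<in> X \<Longrightarrow> b \<in> X \<Longrightarrow> \<exists>u. polygon_cost \<rho> D a b u \<and> u \<le> ennreal e2"
  shows "sets_within_cost \<rho> D (e1 + e2 + e3) C C'"
proof -
  obtain a b u where u: "a \<in> C" "b \<in> X" "polygon_cost \<rho> D a b u" "u \<le> ennreal e1"
    using 1 by (auto simp: sets_within_cost_def)
  obtain c d w where w: "c \<in> X" "d \<in> C'" "polygon_cost \<rho> D c d w" "w \<le> ennreal e3"
    using 3 by (auto simp: sets_within_cost_def)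
  obtain v where v: "polygon_cost \<rho> D b c v" "v \<le> ennreal e2" using X u w by blast
  have "polygon_cost \<rho> D a d (u + v + w)"
    using u v w by (blast intro: polygon_cost_trans)
  moreover have "u + v + w \<le> ennreal (e1 + e2 + e3)"
    using u v w pos by (simp add: add_mono)
  ultimately show ?thesis using u w by (auto simp: sets_within_cost_def)
qed

text \<open>\<open>r\<close> measures how close the continua come to the points, \<open>d\<close>
  how far they reach from them. The threshold \<open>\<epsilon>\<close> serves all densities and all
  continua at once.\<close>

definition linked_at_scale ::
    "real \<Rightarrow> 'a::euclidean_space set \<Rightarrow> real \<Rightarrow> real \<Rightarrow> real \<Rightarrow> real \<Rightarrow> 'a \<Rightarrow> 'a \<Rightarrow> bool" where
  "linked_at_scale p D \<eta> d r \<epsilon> x y \<longleftrightarrow>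
     (\<forall>\<rho>\<in>borel_measurable borel. (\<integral>\<^sup>+ x. ennreal_powr (\<rho> x) p \<partial>lborel) \<le> ennreal \<epsilon> \<longrightarrow>
       (\<forall>C C'. connected C \<and> C \<subseteq> D \<and> C \<inter> cube x r \<noteq> {} \<and> \<not> C \<subseteq> cube x d \<longrightarrow>
               connected C' \<and> C' \<subseteq> D \<and> C' \<inter> cube y r \<noteq> {} \<and> \<not> C' \<subseteq> cube y d \<longrightarrow>
         sets_within_cost \<rho> D \<eta> C C'))"

lemma linked_at_scaleD:
  assumes "linked_at_scale p D \<eta> d r \<epsilon> x y" "\<rho> \<in> borel_measurable borel"
    and "(\<integral>\<^sup>+ x. ennreal_powr (\<rho> x) p \<partial>lborel) \<le> ennreal \<epsilon>"
    and "connected C" "C \<subseteq> D" "C \<inter> cube x r \<noteq> {}" "\<not> C \<subseteq> cube x d"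
    and "connected C'" "C' \<subseteq> D" "C' \<inter> cube y r \<noteq> {}" "\<not> C' \<subseteq> cube y d"
  shows "sets_within_cost \<rho> D \<eta> C C'"
  using assms(1)[unfolded linked_at_scale_def, rule_format, OF assms(2,3), of C C'] assms(4-) by simp

lemma linked_at_scale_sym:
  assumes "linked_at_scale p D \<eta> d r \<epsilon> x y"
  shows "linked_at_scale p D \<eta> d r \<epsilon> y x"
  unfolding linked_at_scale_def
  by (intro ballI allI impI, elim conjE)
    (rule sets_within_cost_sym, assumption, rule linked_at_scaleD[OF assms], assumption+)

text \<open>The order of quantifiers matters for transitivity: \<open>d\<close> can be taken small
  against the room around the middle point, and an intermediate cross can then be centred within the
  resulting \<open>r\<close>.\<close>

definition continua_linked :: "real \<Rightarrow> 'a::euclidean_space set \<Rightarrow> 'a \<Rightarrow> 'a \<Rightarrow> bool" where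
  "continua_linked p D x y \<longleftrightarrow>
     (\<forall>d>0. \<forall>\<eta>>0. \<exists>r>0. \<exists>\<epsilon>>0. linked_at_scale p D \<eta> d r \<epsilon> x y)"

lemma continua_linked_sym:
  "continua_linked p D x y \<Longrightarrow> continua_linked p D y x"
  unfolding continua_linked_def using linked_at_scale_sym by meson

text \<open>The two continua may cross slabs in different coordinate directions. Each is linked to
  the same cheap cross near \<open>x\<close>, at a price of \<open>\<eta> / 4\<close>; moving within
  the cross costs the remaining half of \<open>\<eta>\<close>.\<close>

lemma continua_linked_nearby:
  fixes x :: "'a::euclidean_space"
  assumes n: "DIM('a) \<ge> 2" and p: "p > real DIM('a) - 1" and R: "R > 0" "cube x R \<subseteq> D"
    and y: "y \<in> cube x (R / 4)"
  shows "continua_linked p D x y"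
  unfolding continua_linked_def
proof (intro allI impI)
  fix d \<eta> :: real assume d: "d > 0" and \<eta>: "\<eta> > 0"
  define d' where "d' = min d (R / 4)"
  have d': "d' > 0" "d' \<le> d" "d' \<le> R / 4" using d R by (auto simp: d'_def)
  \<comment> \<open>With the centre within \<open>R / 4\<close> of \<open>x\<close> in each
    coordinate, the cross stays in \<open>cube x R\<close>, and its arms reach every height within
    \<open>R / 2\<close> of \<open>x\<close>. The slabs used lie in that range, as \<open>y\<close>
    and \<open>d'\<close> contribute at most \<open>R / 4\<close> each.\<close>
  define L where "L = 3 * R / 4"
  obtain \<epsilon>1 where \<epsilon>1: "\<epsilon>1 > 0" and slices: "\<forall>\<rho> i a b C C'. \<rho> \<in> borel_measurable borel \<longrightarrow>
      (\<integral>\<^sup>+ x. ennreal_powr (\<rho> x) p \<partial>lborel) \<le> ennreal \<epsilon>1 \<longrightarrow>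
      i \<in> Basis \<longrightarrow> d' / 2 \<le> b - a \<longrightarrow> {a<..<b} \<subseteq> {x \<bullet> i - R..x \<bullet> i + R} \<longrightarrow>
      (\<forall>t\<in>{a<..<b}. \<exists>c\<in>C \<inter> cube x R. c \<bullet> i = t) \<longrightarrow>
      (\<forall>t\<in>{a<..<b}. \<exists>c\<in>C' \<inter> cube x R. c \<bullet> i = t) \<longrightarrow>
      (\<exists>c\<in>C \<inter> cube x R. \<exists>c'\<in>C' \<inter> cube x R. \<exists>w\<in>cube x R.
        segment_cost \<rho> c w + segment_cost \<rho> c' w \<le> ennreal (\<eta> / 4))"
    using connect_across_slices[OF n p R(1), of "d' / 2" "\<eta> / 4" x] d' \<eta> by auto
  have "p \<ge> 1" using n p by simp
  from exists_cheap_cross[OF this, of "R / 4" L R "\<eta> / 4" x]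
  obtain \<epsilon>2 where \<epsilon>2: "\<epsilon>2 > 0" and crosses: "\<forall>\<rho>. \<rho> \<in> borel_measurable borel \<longrightarrow>
      (\<integral>\<^sup>+ x. ennreal_powr (\<rho> x) p \<partial>lborel) \<le> ennreal \<epsilon>2 \<longrightarrow>
      (\<exists>z\<in>cube x (R / 4). \<forall>k\<in>Basis. (\<integral>\<^sup>+ s \<in> {-L..L}. \<rho> (z + s *\<^sub>R k) \<partial>lborel) \<le> ennreal (\<eta> / 4))"
    using R \<eta> by (auto simp: L_def)
  have main: "sets_within_cost \<rho> D \<eta> C C'"
    if \<rho>: "\<rho> \<in> borel_measurable borel" and I: "(\<integral>\<^sup>+ x. ennreal_powr (\<rho> x) p \<partial>lborel) \<le> ennreal (min \<epsilon>1 \<epsilon>2)"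
      and C: "connected C" "C \<inter> cube x (d' / 2) \<noteq> {}" "\<not> C \<subseteq> cube x d"
      and C': "connected C'" "C' \<inter> cube y (d' / 2) \<noteq> {}" "\<not> C' \<subseteq> cube y d" for \<rho> C C'
  proof -
    have I': "(\<integral>\<^sup>+ x. ennreal_powr (\<rho> x) p \<partial>lborel) \<le> ennreal \<epsilon>1" "(\<integral>\<^sup>+ x. ennreal_powr (\<rho> x) p \<partial>lborel) \<le> ennreal \<epsilon>2"
      by (rule order_trans[OF I], simp add: ennreal_leI)+
    obtain z where z: "z \<in> cube x (R / 4)" and
      cheap: "\<forall>k\<in>Basis. (\<integral>\<^sup>+ s \<in> {-L..L}. \<rho> (z + s *\<^sub>R k) \<partial>lborel) \<le> ennreal (\<eta> / 4)"
      using crosses \<rho> I' by blast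
    have cross: "cross z L \<subseteq> cube x R" using R by (intro cross_subset_cube[OF z]) (auto simp: L_def)
    have to_cross: "sets_within_cost \<rho> D (\<eta> / 4) K (cross z L)"
      if K: "connected K" "K \<inter> cube v (d' / 2) \<noteq> {}" "\<not> K \<subseteq> cube v d" and v: "v \<in> cube x (R / 4)" for K v
    proof -
      \<comment> \<open>With inner radius \<open>d' / 2\<close> and outer radius \<open>d'\<close>
        the slab has width \<open>d' / 2\<close>, the width for which \<open>\<epsilon>1\<close> was
        chosen.\<close>
      have "\<not> K \<subseteq> cube v d'" using K(3) d' cube_mono by blast
      from connected_leaving_cube_meets_slices[OF K(1,2) this] d'
      obtain i a b where i: "i \<in> Basis" and ab: "b - a = d' - d' / 2" "{a<..<b} \<subseteq> {v \<bullet> i - d'..v \<bullet> i + d'}"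
        and meets: "\<forall>t\<in>{a<..<b}. \<exists>c\<in>K \<inter> cube v d'. c \<bullet> i = t" by auto
      have vi: "\<bar>v \<bullet> i - x \<bullet> i\<bar> \<le> R / 4" and zi: "\<bar>z \<bullet> i - x \<bullet> i\<bar> \<le> R / 4"
        using v z i by (auto simp: mem_cube)
      have ab2: "\<bar>t - x \<bullet> i\<bar> \<le> R / 2" if "t \<in> {a<..<b}" for t
      proof -
        have "t \<in> {v \<bullet> i - d'..v \<bullet> i + d'}" using ab(2) that by blast
        then have "v \<bullet> i - d' \<le> t" "t \<le> v \<bullet> i + d'" by auto
        then show ?thesis using vi d'(3) by linarith
      qed
      have "cube v d' \<subseteq> cube x R"
      proof
        fix c assume c: "c \<in> cube v d'"
        show "c \<in> cube x R" unfolding mem_cube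
        proof
          fix j :: 'a assume "j \<in> Basis"
          then have "\<bar>c \<bullet> j - v \<bullet> j\<bar> \<le> d'" "\<bar>v \<bullet> j - x \<bullet> j\<bar> \<le> R / 4" using c v by (auto simp: mem_cube)
          then show "\<bar>c \<bullet> j - x \<bullet> j\<bar> \<le> R" using d' R(1) by linarith
        qed
      qed
      then have 1: "\<forall>t\<in>{a<..<b}. \<exists>c\<in>K \<inter> cube x R. c \<bullet> i = t" using meets by blast
      have 2: "\<forall>t\<in>{a<..<b}. \<exists>c\<in>cross z L \<inter> cube x R. c \<bullet> i = t"
      proof
        fix t assume t: "t \<in> {a<..<b}"
        have "z + (t - z \<bullet> i) *\<^sub>R i \<in> cross z L"
          using ab2[OF t] zi i unfolding L_def by (intro crossI) linarith+
        moreover have "(z + (t - z \<bullet> i) *\<^sub>R i) \<bullet> i = t" using i by (simp add: inner_add_left)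
        ultimately show "\<exists>c\<in>cross z L \<inter> cube x R. c \<bullet> i = t" using cross by blast
      qed
      have 3: "{a<..<b} \<subseteq> {x \<bullet> i - R..x \<bullet> i + R}"
      proof
        fix t assume "t \<in> {a<..<b}"
        from ab2[OF this] R(1) have "x \<bullet> i - R \<le> t" "t \<le> x \<bullet> i + R" by linarith+
        then show "t \<in> {x \<bullet> i - R..x \<bullet> i + R}" by simp
      qed
      have "d' / 2 \<le> b - a" using ab by simp
      from slices[rule_format, OF \<rho> I'(1) i this 3 1[rule_format] 2[rule_format]]
      obtain c c' w where c: "c \<in> K \<inter> cube x R" "c' \<in> cross z L \<inter> cube x R" "w \<in> cube x R"
        and le: "segment_cost \<rho> c w + segment_cost \<rho> c' w \<le> ennreal (\<eta> / 4)" by blast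
      have "closed_segment c w \<subseteq> D" "closed_segment c' w \<subseteq> D"
        using c R(2) closed_segment_subset[OF _ _ convex_cube, of _ x R] by blast+
      then have "polygon_cost \<rho> D c c' (segment_cost \<rho> c w + segment_cost \<rho> c' w)"
        using \<rho> by (blast intro: polygon_cost_trans polygon_cost_sym polygon_cost_segment)
      then show ?thesis using c le unfolding sets_within_cost_def by blast
    qed
    have within: "\<exists>u. polygon_cost \<rho> D a b u \<and> u \<le> ennreal (2 * (\<eta> / 4))"
      if "a \<in> cross z L" "b \<in> cross z L" for a b
      using that cross R \<eta> by (intro polygon_cost_within_cross[OF \<rho> _ _ _ cheap]) (auto simp: L_def)
    have "x \<in> cube x (R / 4)" using R by (simp add: mem_cube)
    then have "sets_within_cost \<rho> D (\<eta> / 4) C (cross z L)" using C to_cross by blast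
    moreover have "sets_within_cost \<rho> D (\<eta> / 4) (cross z L) C'"
      using C' y to_cross \<rho> by (blast intro: sets_within_cost_sym)
    ultimately have "sets_within_cost \<rho> D (\<eta> / 4 + 2 * (\<eta> / 4) + \<eta> / 4) C C'"
      using \<eta> within by (intro sets_within_cost_through[OF \<rho>, where X = "cross z L"]) auto
    then show ?thesis by simp
  qed
  have "linked_at_scale p D \<eta> d (d' / 2) (min \<epsilon>1 \<epsilon>2) x y"
    unfolding linked_at_scale_def by (intro ballI allI impI, elim conjE) (rule main)
  then show "\<exists>r>0. \<exists>\<epsilon>>0. linked_at_scale p D \<eta> d r \<epsilon> x y"
    using d' \<epsilon>1 \<epsilon>2 by (intro exI[of _ "d' / 2"] exI[of _ "min \<epsilon>1 \<epsilon>2"] conjI) auto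
qed

text \<open>A cheap cross centred close to \<open>y\<close> is itself a continuum that qualifies for
  both links, so it can be the end of one and the start of the other.\<close>

lemma continua_linked_trans:
  fixes y :: "'a::euclidean_space"
  assumes p: "p \<ge> 1" and D: "open D" "y \<in> D"
    and xy: "continua_linked p D x y" and yw: "continua_linked p D y w"
  shows "continua_linked p D x w"
  unfolding continua_linked_def
proof (intro allI impI)
  fix d \<eta> :: real assume d: "d > 0" and \<eta>: "\<eta> > 0"
  obtain R where R: "R > 0" "cube y R \<subseteq> D" using cube_subset_open[OF D] by blast
  define d' where "d' = min d (R / 4)"
  have d': "d' > 0" "d' \<le> d" "d' \<le> R / 4" using d R by (auto simp: d'_def)
  have "\<eta> / 4 > 0" using \<eta> by simp
  obtain r1 \<epsilon>1 where 1: "r1 > 0" "\<epsilon>1 > 0" and xy': "linked_at_scale p D (\<eta> / 4) d' r1 \<epsilon>1 x y"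
    using xy d'(1) \<open>\<eta> / 4 > 0\<close> unfolding continua_linked_def by blast
  obtain r2 \<epsilon>2 where 2: "r2 > 0" "\<epsilon>2 > 0" and yw': "linked_at_scale p D (\<eta> / 4) d' r2 \<epsilon>2 y w"
    using yw d'(1) \<open>\<eta> / 4 > 0\<close> unfolding continua_linked_def by blast
  define r where "r = min (min r1 r2) (R / 4)"
  have r: "r > 0" "r \<le> r1" "r \<le> r2" "r \<le> R / 4" using 1 2 R by (auto simp: r_def)
  define L where "L = 3 * R / 4"
  from exists_cheap_cross[OF p, of r L R "\<eta> / 4" y]
  obtain \<epsilon>3 where 3: "\<epsilon>3 > 0" and crosses: "\<forall>\<rho>. \<rho> \<in> borel_measurable borel \<longrightarrow>
      (\<integral>\<^sup>+ x. ennreal_powr (\<rho> x) p \<partial>lborel) \<le> ennreal \<epsilon>3 \<longrightarrow>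
      (\<exists>z\<in>cube y r. \<forall>k\<in>Basis. (\<integral>\<^sup>+ s \<in> {-L..L}. \<rho> (z + s *\<^sub>R k) \<partial>lborel) \<le> ennreal (\<eta> / 4))"
    using R \<eta> r by (auto simp: L_def)
  define \<epsilon> where "\<epsilon> = min (min \<epsilon>1 \<epsilon>2) \<epsilon>3"
  have \<epsilon>: "\<epsilon> > 0" using 1 2 3 by (simp add: \<epsilon>_def)
  have main: "sets_within_cost \<rho> D \<eta> C C'"
    if \<rho>: "\<rho> \<in> borel_measurable borel" and I: "(\<integral>\<^sup>+ x. ennreal_powr (\<rho> x) p \<partial>lborel) \<le> ennreal \<epsilon>"
      and C: "connected C" "C \<subseteq> D" "C \<inter> cube x r \<noteq> {}" "\<not> C \<subseteq> cube x d"
      and C': "connected C'" "C' \<subseteq> D" "C' \<inter> cube w r \<noteq> {}" "\<not> C' \<subseteq> cube w d" for \<rho> C C'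
  proof -
    have I': "(\<integral>\<^sup>+ x. ennreal_powr (\<rho> x) p \<partial>lborel) \<le> ennreal e" if "e \<in> {\<epsilon>1, \<epsilon>2, \<epsilon>3}" for e
      by (rule order_trans[OF I]) (use that in \<open>auto simp: \<epsilon>_def intro!: ennreal_leI\<close>)
    obtain z where z: "z \<in> cube y r" and
      cheap: "\<forall>k\<in>Basis. (\<integral>\<^sup>+ s \<in> {-L..L}. \<rho> (z + s *\<^sub>R k) \<partial>lborel) \<le> ennreal (\<eta> / 4)"
      using crosses \<rho> I' by blast
    have L: "L \<ge> 0" using R by (simp add: L_def)
    have "cross z L \<subseteq> cube y R" using R r by (intro cross_subset_cube[OF z]) (auto simp: L_def)
    then have XD: "cross z L \<subseteq> D" using R by blast
    obtain k :: 'a where k: "k \<in> Basis" using nonempty_Basis by blast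
    have zX: "z \<in> cross z L" using L by (rule center_in_cross)
    \<comment> \<open>The tip of an arm is at least \<open>L - r\<close>, hence at least
      \<open>R / 2\<close>, away from \<open>y\<close> in its direction, while \<open>d'\<close> is
      at most \<open>R / 4\<close>.\<close>
    have out: "\<not> cross z L \<subseteq> cube y d'"
    proof
      assume "cross z L \<subseteq> cube y d'"
      moreover have "z + L *\<^sub>R k \<in> cross z L" using L k by (intro crossI) auto
      ultimately have "\<bar>(z + L *\<^sub>R k) \<bullet> k - y \<bullet> k\<bar> \<le> d'" using k by (auto simp: mem_cube)
      moreover have "\<bar>z \<bullet> k - y \<bullet> k\<bar> \<le> r" using z k by (auto simp: mem_cube)
      ultimately show False using k r d' R by (auto simp: inner_add_left L_def abs_le_iff)
    qed
    have X: "connected (cross z L)" using L by (rule connected_cross)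
    have meet: "C \<inter> cube x r1 \<noteq> {}" "C' \<inter> cube w r2 \<noteq> {}"
      "cross z L \<inter> cube y r1 \<noteq> {}" "cross z L \<inter> cube y r2 \<noteq> {}"
      using C(3) C'(3) z zX cube_mono[OF r(2)] cube_mono[OF r(3)] by blast+
    have leave: "\<not> C \<subseteq> cube x d'" "\<not> C' \<subseteq> cube w d'"
      using C(4) C'(4) cube_mono[OF d'(2)] by blast+
    have "sets_within_cost \<rho> D (\<eta> / 4) C (cross z L)"
      by (rule linked_at_scaleD[OF xy' \<rho> I' C(1,2) meet(1) leave(1) X XD meet(3) out]) simp
    moreover have "sets_within_cost \<rho> D (\<eta> / 4) (cross z L) C'"
      by (rule linked_at_scaleD[OF yw' \<rho> I' X XD meet(4) out C'(1,2) meet(2) leave(2)]) simp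
    ultimately have "sets_within_cost \<rho> D (\<eta> / 4 + 2 * (\<eta> / 4) + \<eta> / 4) C C'"
      using \<eta> polygon_cost_within_cross[OF \<rho> XD L _ cheap]
      by (intro sets_within_cost_through[OF \<rho>, where X = "cross z L"]) auto
    then show ?thesis by simp
  qed
  have "linked_at_scale p D \<eta> d r \<epsilon> x w"
    unfolding linked_at_scale_def by (intro ballI allI impI, elim conjE) (rule main)
  then show "\<exists>r>0. \<exists>\<epsilon>>0. linked_at_scale p D \<eta> d r \<epsilon> x w"
    using r \<epsilon> by blast
qed

text \<open>The chain of cubes is hidden in a connectedness argument: the relation is symmetric and
  transitive on \<open>D\<close>, and by \<open>continua_linked_nearby\<close> each point is related
  to a whole neighborhood.\<close>

lemma continua_linked_domain:
  fixes D :: "'a::euclidean_space set"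
  assumes n: "DIM('a) \<ge> 2" and p: "p > real DIM('a) - 1" and D: "open D" "connected D"
    and xy: "x \<in> D" "y \<in> D"
  shows "continua_linked p D x y"
proof (rule connected_equivalence_relation[OF D(2) xy])
  have p1: "p \<ge> 1" using n p by simp
  show "continua_linked p D v u" if "continua_linked p D u v" for u v
    using that by (rule continua_linked_sym)
  show "continua_linked p D u w" if "continua_linked p D u v" "continua_linked p D v w" "v \<in> D" for u v w
    using continua_linked_trans[OF p1 D(1)] that by blast
  show "\<exists>T. openin (top_of_set D) T \<and> a \<in> T \<and> (\<forall>x\<in>T. continua_linked p D a x)" if a: "a \<in> D" for a
  proof -
    obtain R where R: "R > 0" "cube a R \<subseteq> D" using cube_subset_open[OF D(1) a] by blast
    have "ball a (R / 4) \<subseteq> cube a (R / 4)" by (rule ball_subset_cube)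
    moreover from this have "ball a (R / 4) \<subseteq> D" using R cube_mono[of "R / 4" R a] by auto
    ultimately show ?thesis
      using R continua_linked_nearby[OF n p R]
      by (intro exI[of _ "ball a (R / 4)"]) (auto intro: open_subset)
  qed
qed

section \<open>Comparing moduli of path families\<close>

text \<open>A polygon that already ends in \<open>F\<close> can thus be prepended to a path resting
  at its end point.\<close>

lemma line_integral_constant [simp]: "line_integral \<rho> (a, b, \<lambda>t. c) = 0"
proof -
  have "curve_length (\<lambda>t. c) a b \<le> 0" by (rule curve_length_leI) simp
  then have "curve_length (\<lambda>t. c) a b = 0" by simp
  then show ?thesis by (simp add: line_integral_def nn_integral_indicator_singleton)
qed

lemma locally_rectifiable_constant: "locally_rectifiable (a, b, \<lambda>t. c)"
proof -
  have "curve_length (\<lambda>t. c) u v \<le> 0" for u v by (rule curve_length_leI) simp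
  then show ?thesis by (simp add: locally_rectifiable_def)
qed

lemma line_integral_cmult_ge:
  "k * line_integral \<rho> c \<le> line_integral (\<lambda>x. k * \<rho> x) c"
proof (cases c)
  case (fields a b \<gamma>)
  show ?thesis
    using nn_integral_cmult_ge[of k lborel "\<lambda>s. \<rho> (arclength_param (a, b, \<gamma>) s) *
      indicator {0..enn2real (curve_length \<gamma> a b)} s"]
    unfolding fields line_integral_def by (simp add: mult.assoc)
qed

lemma ennreal_powr_cmult:
  assumes "k > 0" "p > 0"
  shows "ennreal_powr (ennreal k * x) p = ennreal (k powr p) * ennreal_powr x p"
proof (cases x)
  case (real r)
  then have kx: "ennreal k * x = ennreal (k * r)" using assms by (simp add: ennreal_mult)
  show ?thesis unfolding kx unfolding real(2) using real assms
    by (simp add: ennreal_powr_def powr_mult flip: ennreal_mult)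
next
  case top
  then show ?thesis using assms by (simp add: ennreal_powr_def ennreal_mult_top)
qed

lemma not_subset_small_cube:
  fixes F :: "'a::euclidean_space set"
  assumes "u \<in> F" "v \<in> F" "dist u v > s" "d \<le> s / (2 * real DIM('a))"
  shows "\<not> F \<subseteq> cube y d"
proof
  assume "F \<subseteq> cube y d"
  then have "dist u v \<le> real DIM('a) * (2 * d)" using assms by (intro dist_cube_le[of u y d]) auto
  also have "\<dots> \<le> s" using assms(4) by (simp add: field_simps)
  finally show False using assms by simp
qed

lemma joining_paths_image_subset:
  assumes "(a, b, \<gamma>) \<in> joining_paths E F D" "E \<subseteq> D" "F \<subseteq> D"
  shows "\<gamma> ` {a..b} \<subseteq> D"
proof clarify
  fix t assume "t \<in> {a..b}"
  then consider "t = a" | "t = b" | "a < t" "t < b" by fastforce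
  then show "\<gamma> t \<in> D" using assms by cases (auto simp: joining_paths_def)
qed

text \<open>The polygon is continued from \<open>c\<close> to \<open>F\<close> at no more than the
  cost of \<open>\<gamma>\<close>: by a resting path if \<open>c\<close> lies in \<open>F\<close>,
  by the rest of \<open>\<gamma>\<close> otherwise. The result joins \<open>Estar\<close> to
  \<open>F\<close> inside \<open>D\<close>.\<close>

lemma admissible_cost_from_continuum:
  fixes D :: "'a::euclidean_space set"
  assumes \<rho>: "\<rho> \<in> admissible (joining_paths Estar F D)" and F: "F \<subseteq> D"
    and path: "(a, b, \<gamma>) \<in> joining_paths E F D" "E \<subseteq> D" "locally_rectifiable (a, b, \<gamma>)"
    and poly: "polygon_cost \<rho> D e c u" "e \<in> Estar" "c \<in> \<gamma> ` {a..b} \<union> F"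
  shows "1 \<le> u + line_integral \<rho> (a, b, \<gamma>)"
proof -
  have \<rho>b: "\<rho> \<in> borel_measurable borel" using \<rho> by (simp add: admissible_def)
  have ab: "a < b" "continuous_on {a..b} \<gamma>" "\<gamma> b \<in> F"
    using path by (auto simp: joining_paths_def)
  have img: "\<gamma> ` {a..b} \<subseteq> D"
    using path F by (intro joining_paths_image_subset)
  have admissibleD: "1 \<le> line_integral \<rho> (a', b', \<gamma>')"
    if "a' < b'" "continuous_on {a'..b'} \<gamma>'" "\<gamma>' ` {a'..b'} \<subseteq> D" "locally_rectifiable (a', b', \<gamma>')"
      "\<gamma>' a' \<in> Estar" "\<gamma>' b' \<in> F" for a' b' \<gamma>'
  proof -
    have "(a', b', \<gamma>') \<in> joining_paths Estar F D" using that by (auto simp: joining_paths_def)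
    then show ?thesis using \<rho> that(4) by (auto simp: admissible_def)
  qed
  obtain a1 b1 \<gamma>1 where 1: "a1 < b1" "continuous_on {a1..b1} \<gamma>1" "\<gamma>1 ` {a1..b1} \<subseteq> D"
      "locally_rectifiable (a1, b1, \<gamma>1)" "\<gamma>1 a1 = c" "\<gamma>1 b1 \<in> F"
      "line_integral \<rho> (a1, b1, \<gamma>1) \<le> line_integral \<rho> (a, b, \<gamma>)"
  proof (cases "c \<in> F")
    case True
    then show ?thesis using that[of 0 1 "\<lambda>t. c"] F locally_rectifiable_constant by auto
  next
    case False
    then obtain t where t: "t \<in> {a..b}" "c = \<gamma> t" using poly by blast
    with False ab have tb: "t < b" by (cases "t = b") auto
    have "locally_rectifiable (t, b, \<gamma>)"
      using t tb locally_rectifiable_finite[OF path(3), of t b] by (intro locally_rectifiableI) auto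
    moreover have "line_integral \<rho> (t, b, \<gamma>) \<le> line_integral \<rho> (a, b, \<gamma>)"
      using t by (intro line_integral_subpath_le[OF path(3)]) auto
    moreover have "continuous_on {t..b} \<gamma>" "\<gamma> ` {t..b} \<subseteq> D"
      using t img by (auto intro: continuous_on_subset[OF ab(2)])
    ultimately show ?thesis using that[of t b \<gamma>] tb t ab by auto
  qed
  from prepend_polygon[OF poly(1) \<rho>b 1(1-5)] obtain a' \<gamma>' where
    "a' < b1" "continuous_on {a'..b1} \<gamma>'" "\<gamma>' ` {a'..b1} \<subseteq> D" "locally_rectifiable (a', b1, \<gamma>')"
    "\<gamma>' a' = e" "\<gamma>' b1 = \<gamma>1 b1" "line_integral \<rho> (a', b1, \<gamma>') \<le> u + line_integral \<rho> (a1, b1, \<gamma>1)"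
    by blast
  then have "1 \<le> u + line_integral \<rho> (a1, b1, \<gamma>1)"
    using admissibleD[of a' b1 \<gamma>'] poly 1 by (auto intro: order_trans)
  also have "\<dots> \<le> u + line_integral \<rho> (a, b, \<gamma>)" using 1 by (intro add_left_mono)
  finally show ?thesis .
qed

lemma p_modulus_continuum_transfer:
  fixes D :: "'a::euclidean_space set" and p :: real
  assumes n: "DIM('a) \<ge> 2" and p: "p > real DIM('a) - 1" and D: "open D" "connected D"
    and E: "compact E" "E \<subseteq> D" and Es: "nondegenerate_continuum Estar" "Estar \<subseteq> D"
    and pos: "\<delta> > 0" "s > 0"
  shows "\<exists>\<delta>star>0. \<forall>F. connected F \<and> F \<subseteq> D \<and> (\<exists>u\<in>F. \<exists>v\<in>F. dist u v > s) \<and>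
    ennreal \<delta> \<le> p_modulus p (joining_paths E F D) \<longrightarrow>
      ennreal \<delta>star \<le> p_modulus p (joining_paths Estar F D)"
proof -
  obtain e e' where e: "e \<in> Estar" "e' \<in> Estar" "e \<noteq> e'" and conE: "connected Estar"
    using Es by (auto simp: nondegenerate_continuum_def)
  \<comment> \<open>\<open>d\<close> is so small that neither \<open>Estar\<close> nor a set with
    two points more than \<open>s\<close> apart fits into a cube of radius \<open>d\<close>; halving
    the distance makes the inequality for \<open>Estar\<close> strict.\<close>
  define s' where "s' = min s (dist e e' / 2)"
  have s': "s' > 0" "s' \<le> s" "s' < dist e e'" using pos e by (auto simp: s'_def min_def)
  define d where "d = s' / (2 * real DIM('a))"
  have d: "d > 0" using s' by (simp add: d_def)
  have outE: "\<not> Estar \<subseteq> cube e d"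
    by (rule not_subset_small_cube[OF e(1,2) s'(3)]) (simp add: d_def)
  have p1: "p > 1" using n p by simp
  have "\<exists>r>0. \<exists>\<epsilon>>0. linked_at_scale p D (1 / 3) d r \<epsilon> e y" if "y \<in> E" for y
  proof -
    have "continua_linked p D e y" using continua_linked_domain[OF n p D] that e Es(2) E(2) by blast
    then show ?thesis using d unfolding continua_linked_def by simp
  qed
  then obtain r \<epsilon> where r: "\<And>y. y \<in> E \<Longrightarrow> r y > 0" and \<epsilon>: "\<And>y. y \<in> E \<Longrightarrow> \<epsilon> y > 0"
    and link: "\<And>y. y \<in> E \<Longrightarrow> linked_at_scale p D (1 / 3) d (r y) (\<epsilon> y) e y"
    by metis
  have "E \<subseteq> (\<Union>y\<in>E. ball y (r y))" using r by auto
  from compactE_image[OF E(1) _ this]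
  obtain Y where Y: "Y \<subseteq> E" "finite Y" "E \<subseteq> (\<Union>y\<in>Y. ball y (r y))" by auto
  \<comment> \<open>The element 1 keeps the minimum meaningful when \<open>E\<close>, and with it
    \<open>Y\<close>, is empty.\<close>
  define \<epsilon>0 where "\<epsilon>0 = Min (insert 1 (\<epsilon> ` Y))"
  have \<epsilon>0: "\<epsilon>0 > 0" "\<And>y. y \<in> Y \<Longrightarrow> \<epsilon>0 \<le> \<epsilon> y" using Y \<epsilon> by (auto simp: \<epsilon>0_def)
  \<comment> \<open>The first entry makes the links applicable. The second absorbs the factor
    \<open>2 powr p\<close> by which the energy grows when the density is doubled.\<close>
  define \<delta>s where "\<delta>s = min \<epsilon>0 (\<delta> / 2 powr p)"
  have \<delta>s: "\<delta>s > 0" using \<epsilon>0 pos by (simp add: \<delta>s_def)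
  have main: "ennreal \<delta>s \<le> p_modulus p (joining_paths Estar F D)"
    if F: "connected F" "F \<subseteq> D" "u \<in> F" "v \<in> F" "dist u v > s"
      and mod: "ennreal \<delta> \<le> p_modulus p (joining_paths E F D)" for F u v
    unfolding p_modulus_def
  proof (rule INF_greatest, rule ccontr)
    fix \<rho> assume adm: "\<rho> \<in> admissible (joining_paths Estar F D)"
      and "\<not> ennreal \<delta>s \<le> (\<integral>\<^sup>+ x. ennreal_powr (\<rho> x) p \<partial>lborel)"
    then have I: "(\<integral>\<^sup>+ x. ennreal_powr (\<rho> x) p \<partial>lborel) < ennreal \<delta>s" by simp
    have \<rho> [measurable]: "\<rho> \<in> borel_measurable borel" using adm by (simp add: admissible_def)
    have half: "ennreal (1 / 2) \<le> line_integral \<rho> (a, b, \<gamma>)"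
      if path: "(a, b, \<gamma>) \<in> joining_paths E F D" and rect: "locally_rectifiable (a, b, \<gamma>)" for a b \<gamma>
    proof -
      \<comment> \<open>The path brings this set close to a centre in \<open>Y\<close>, and
        \<open>F\<close> makes it large, so \<open>F\<close> itself need not come near
        \<open>E\<close>.\<close>
      let ?C = "\<gamma> ` {a..b} \<union> F"
      have ab: "a < b" "continuous_on {a..b} \<gamma>" "\<gamma> a \<in> E" "\<gamma> b \<in> F"
        using path by (auto simp: joining_paths_def)
      have "connected (\<gamma> ` {a..b})" by (rule connected_continuous_image[OF ab(2)]) simp
      moreover have "\<gamma> b \<in> \<gamma> ` {a..b} \<inter> F" using ab by auto
      ultimately have conn: "connected ?C" using F(1) by (intro connected_Un) blast+
      have sub: "?C \<subseteq> D"
        using joining_paths_image_subset[OF path E(2) F(2)] F(2) by blast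
      obtain y where y: "y \<in> Y" "\<gamma> a \<in> ball y (r y)" using Y(3) ab(3) by blast
      have yE: "y \<in> E" using y(1) Y(1) by blast
      have "\<gamma> a \<in> ?C \<inter> cube y (r y)" using y(2) ball_subset_cube[of y "r y"] ab(1) by auto
      then have meets: "?C \<inter> cube y (r y) \<noteq> {}" by blast
      have out: "\<not> ?C \<subseteq> cube y d"
        using not_subset_small_cube[of u F v s' d y] F s' by (auto simp: d_def)
      have "e \<in> Estar \<inter> cube e (r y)" using r[OF yE] e(1) by (simp add: mem_cube)
      then have meetsE: "Estar \<inter> cube e (r y) \<noteq> {}" by blast
      have I\<epsilon>: "(\<integral>\<^sup>+ x. ennreal_powr (\<rho> x) p \<partial>lborel) \<le> ennreal (\<epsilon> y)"
        using \<epsilon>0(2)[OF y(1)] by (intro order_trans[OF less_imp_le[OF I]] ennreal_leI) (simp add: \<delta>s_def)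
      have "sets_within_cost \<rho> D (1 / 3) Estar ?C"
        by (rule linked_at_scaleD[OF link[OF yE] \<rho> I\<epsilon> conE Es(2) meetsE outE conn sub meets out])
      then obtain x c w where xc: "x \<in> Estar" "c \<in> ?C" "polygon_cost \<rho> D x c w" "w \<le> ennreal (1 / 3)"
        by (auto simp: sets_within_cost_def)
      have "1 \<le> w + line_integral \<rho> (a, b, \<gamma>)"
        by (rule admissible_cost_from_continuum[OF adm F(2) path E(2) rect xc(3,1,2)])
      also have "\<dots> \<le> ennreal (1 / 3) + line_integral \<rho> (a, b, \<gamma>)" using xc by (intro add_right_mono)
      finally have *: "1 \<le> ennreal (1 / 3) + line_integral \<rho> (a, b, \<gamma>)" .
      show ?thesis
      proof (cases "line_integral \<rho> (a, b, \<gamma>)")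
        case (real q)
        then have "ennreal 1 \<le> ennreal (1 / 3 + q)" using * by (simp add: ennreal_plus)
        then have "1 / 2 \<le> q" using real by (simp add: ennreal_le_iff del: ennreal_1 ennreal_plus)
        then show ?thesis unfolding real(2) by (rule ennreal_leI)
      qed simp
    qed
    have "(\<lambda>x. ennreal 2 * \<rho> x) \<in> admissible (joining_paths E F D)"
      unfolding admissible_def
    proof (safe; (measurable)?)
      fix a b \<gamma> assume path: "(a, b, \<gamma>) \<in> joining_paths E F D" "locally_rectifiable (a, b, \<gamma>)"
      have "1 = ennreal 2 * ennreal (1 / 2)" by (subst ennreal_mult[symmetric]) simp_all
      also have "\<dots> \<le> ennreal 2 * line_integral \<rho> (a, b, \<gamma>)"
        using path by (intro mult_left_mono half) auto
      also have "\<dots> \<le> line_integral (\<lambda>x. ennreal 2 * \<rho> x) (a, b, \<gamma>)"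
        by (rule line_integral_cmult_ge)
      finally show "1 \<le> line_integral (\<lambda>x. ennreal 2 * \<rho> x) (a, b, \<gamma>)" .
    qed
    then have "p_modulus p (joining_paths E F D) \<le> (\<integral>\<^sup>+ x. ennreal_powr (ennreal 2 * \<rho> x) p \<partial>lborel)"
      unfolding p_modulus_def by (rule INF_lower)
    also have "\<dots> = ennreal (2 powr p) * (\<integral>\<^sup>+ x. ennreal_powr (\<rho> x) p \<partial>lborel)"
      using p1 by (simp add: ennreal_powr_cmult nn_integral_cmult del: ennreal_numeral)
    also have "\<dots> < ennreal (2 powr p) * ennreal \<delta>s"
      using I by (intro ennreal_mult_strict_left_mono) auto
    also have "\<dots> \<le> ennreal \<delta>"
      using pos \<delta>s by (simp add: \<delta>s_def min_def field_simps flip: ennreal_mult)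
    finally show False using mod by simp
  qed
  show ?thesis using \<delta>s main by blast
qed

theorem theorem1p2:
  fixes D :: "(real ^ 'n) set" and x0 :: "real ^ 'n" and p :: real
  assumes "CARD('n) \<ge> 2"
    and "p > real CARD('n) - 1"
    and "open D" and "connected D"
    and "x0 \<in> frontier D"
    and "\<And>U. open U \<Longrightarrow> x0 \<in> U \<Longrightarrow>
           \<exists>E V. \<exists>\<delta>::real. compact E \<and> E \<subseteq> D \<and> open V \<and> x0 \<in> V \<and> V \<subseteq> U \<and> \<delta> > 0 \<and>
             (\<forall>F. nondegenerate_continuum F \<and> F \<subseteq> D \<and>
                  F \<inter> frontier U \<noteq> {} \<and> F \<inter> frontier V \<noteq> {} \<longrightarrow>
                  p_modulus p (joining_paths E F D) \<ge> ennreal \<delta>)"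
  shows "\<forall>U Estar. open U \<and> x0 \<in> U \<and> nondegenerate_continuum Estar \<and> Estar \<subseteq> D \<longrightarrow>
           (\<exists>V. \<exists>\<delta>star::real. open V \<and> x0 \<in> V \<and> V \<subseteq> U \<and> \<delta>star > 0 \<and>
             (\<forall>F. nondegenerate_continuum F \<and> F \<subseteq> D \<and>
                  F \<inter> frontier U \<noteq> {} \<and> F \<inter> frontier V \<noteq> {} \<longrightarrow>
                  p_modulus p (joining_paths Estar F D) \<ge> ennreal \<delta>star))"
proof (intro allI impI, elim conjE)
  fix U Estar assume U: "open U" "x0 \<in> U" and Es: "nondegenerate_continuum Estar" "Estar \<subseteq> D"
  from assms(6)[OF U] obtain E V \<delta> where EV: "compact E \<and> E \<subseteq> D \<and> open V \<and> x0 \<in> V \<and> V \<subseteq> U \<and> \<delta> > 0 \<and>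
             (\<forall>F. nondegenerate_continuum F \<and> F \<subseteq> D \<and>
                  F \<inter> frontier U \<noteq> {} \<and> F \<inter> frontier V \<noteq> {} \<longrightarrow>
                  p_modulus p (joining_paths E F D) \<ge> ennreal \<delta>)"
    by (elim exE) (rule that)
  then have E: "compact E" "E \<subseteq> D" and V: "open V" "x0 \<in> V" "V \<subseteq> U" and \<delta>: "\<delta> > 0"
    and hyp: "\<forall>F. nondegenerate_continuum F \<and> F \<subseteq> D \<and>
                  F \<inter> frontier U \<noteq> {} \<and> F \<inter> frontier V \<noteq> {} \<longrightarrow>
                  p_modulus p (joining_paths E F D) \<ge> ennreal \<delta>" by simp_all
  \<comment> \<open>The neighborhood for the conclusion will be the ball of radius
    \<open>s / 2\<close>. A continuum from its sphere to the frontier of \<open>U\<close> leaves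
    \<open>cball x0 s\<close>, so it has two points more than \<open>s / 4\<close> apart, and it
    crosses the frontier of \<open>V\<close>, as the hypothesis requires.\<close>
  obtain s where s: "s > 0" "cball x0 s \<subseteq> V" using V by (meson open_contains_cball)
  have "DIM(real ^ 'n) \<ge> 2" "p > real DIM(real ^ 'n) - 1" using assms by auto
  moreover have "s / 4 > 0" using s by simp
  ultimately have "\<exists>\<delta>star>0. \<forall>F. connected F \<and> F \<subseteq> D \<and> (\<exists>u\<in>F. \<exists>v\<in>F. dist u v > s / 4) \<and>
      ennreal \<delta> \<le> p_modulus p (joining_paths E F D) \<longrightarrow>
      ennreal \<delta>star \<le> p_modulus p (joining_paths Estar F D)"
    by (rule p_modulus_continuum_transfer[OF _ _ assms(3,4) E Es \<delta>])
  then
  obtain \<delta>star where \<delta>star: "\<delta>star > 0" and transfer: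
    "\<forall>F. connected F \<and> F \<subseteq> D \<and> (\<exists>u\<in>F. \<exists>v\<in>F. dist u v > s / 4) \<and>
      ennreal \<delta> \<le> p_modulus p (joining_paths E F D) \<longrightarrow>
      ennreal \<delta>star \<le> p_modulus p (joining_paths Estar F D)" by blast
  have main: "ennreal \<delta>star \<le> p_modulus p (joining_paths Estar F D)"
    if F: "nondegenerate_continuum F" "F \<subseteq> D" "F \<inter> frontier U \<noteq> {}" "F \<inter> frontier (ball x0 (s / 2)) \<noteq> {}"
    for F
  proof -
    have "F \<inter> sphere x0 (s / 2) \<noteq> {}" using F(4) s by (simp add: frontier_ball)
    then obtain u where u: "u \<in> F" "dist x0 u = s / 2" unfolding mem_sphere[symmetric] by blast
    obtain v where v: "v \<in> F" "v \<notin> U" using F(3) U(1) by (auto simp: frontier_def interior_open)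
    have "v \<notin> cball x0 s" using v V s by blast
    then have "dist u v > s / 4" using u s dist_triangle[of x0 v u] by auto
    moreover have conn: "connected F" using F by (simp add: nondegenerate_continuum_def)
    moreover have "F \<inter> frontier V \<noteq> {}"
    proof (rule connected_Int_frontier[OF conn])
      have "u \<in> V" using u s by auto
      then show "F \<inter> V \<noteq> {}" using u by blast
      show "F - V \<noteq> {}" using v V by blast
    qed
    ultimately have "ennreal \<delta> \<le> p_modulus p (joining_paths E F D)" "\<exists>u\<in>F. \<exists>v\<in>F. dist u v > s / 4"
      using hyp[rule_format, of F] F u(1) v(1) by blast+
    then show ?thesis using transfer[rule_format, of F] conn F(2) by blast
  qed
  have sub: "ball x0 (s / 2) \<subseteq> U"
  proof -
    have "ball x0 (s / 2) \<subseteq> cball x0 s" using s by auto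
    then show ?thesis using s V by blast
  qed
  show "\<exists>V. \<exists>\<delta>star::real. open V \<and> x0 \<in> V \<and> V \<subseteq> U \<and> \<delta>star > 0 \<and>
             (\<forall>F. nondegenerate_continuum F \<and> F \<subseteq> D \<and>
                  F \<inter> frontier U \<noteq> {} \<and> F \<inter> frontier V \<noteq> {} \<longrightarrow>
                  p_modulus p (joining_paths Estar F D) \<ge> ennreal \<delta>star)"
    by (intro exI[of _ "ball x0 (s / 2)"] exI[of _ \<delta>star] conjI allI impI; (elim conjE)?)
      (use \<delta>star s(1) sub in \<open>simp_all add: main\<close>)
qed

end
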